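(* Let $d\ge 2$ and let $f:\Delta\to\Delta$ be the projective (unsorted) $d$-dimensional Brun algorithm on the simplex $\Delta=\{(x_1,\dots,x_d)\in\mathbb{R}^d \mid x_i>0 \text{ for all } i,\ \sum_{i=1}^d x_i=1\}$ (as defined in the context, up to a set of Lebesgue measure $0$). Define $\delta$ almost everywhere on $\Delta$ by setting, for $\mathbf{x}=(x_1,\dots,x_d)\in\Lambda_\pi\cap\Delta$, $\pi\in S_d$, $$\delta(\mathbf{x})=\frac{1}{(d-1)!\,x_{\pi(d-1)}}\sum_{A_1\subset A_2\subset\cdots\subset A_{d-1}}\ \prod_{k=1}^{d-1}\frac{1}{1-\sum_{i\in A_k}x_i},$$ where the sum runs over all chains of sets $A_1\subset A_2\subset\cdots\subset A_{d-1}$ with $A_1=\{\pi(d-1)\}$, $A_{d-1}=\{1,2,\dots,d\}\setminus\{\pi(d)\}$ and $|A_k|=k$ for every $k$. Then $\delta$ is the density, with respect to the Lebesgue measure $dx_1\cdots dx_{d-1}$ on $\Delta$, of an $f$-invariant measure; that is, the measure $\mu$ given by $d\mu=\delta\,dx_1\cdots dx_{d-1}$ satisfies $\mu(f^{-1}(B))=\mu(B)$ for every Borel set $B\subseteq\Delta$.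
   Context: Let $\Lambda=\{(x_1,\dots,x_d)\in\mathbb{R}^d\mid x_i>0\text{ for all }i\}$ and, for each permutation $\pi$ in the group $S_d$ of permutations of $\{1,\dots,d\}$, let $\Lambda_\pi=\{(x_1,\dots,x_d)\in\Lambda\mid x_{\pi(1)}<x_{\pi(2)}<\cdots<x_{\pi(d)}\}$. These sets partition $\Lambda$ up to a set of Lebesgue measure zero. The $d$-dimensional Brun algorithm is the map $F$, defined almost everywhere on $\Lambda$, which subtracts the second largest coordinate from the largest one: for $\mathbf{x}\in\Lambda_\pi$, $F(\mathbf{x})$ is obtained from $\mathbf{x}$ by replacing the coordinate $x_{\pi(d)}$ by $x_{\pi(d)}-x_{\pi(d-1)}$ and leaving the other coordinates unchanged (in place). Its projective version is $f:\Delta\to\Delta$, $f(\mathbf{x})=F(\mathbf{x})/\|F(\mathbf{x})\|_1$, where $\|\mathbf{x}\|_1=\sum_i|x_i|$; it is defined almost everywhere on $\Delta$. The coordinates on $\Delta$ are $(x_1,\dots,x_{d-1})$, with $x_d=1-\sum_{i<d}x_i$. *)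

theory Defs
  imports "HOL-Analysis.Analysis" "HOL-Combinatorics.Permutations"
begin

text \<open>
  The dimension \<open>d\<close> is a term-level natural number, so a vector of \<open>\<real>\<^sup>d\<close> is
  a function on the index set \<open>{1..d}\<close> that is \<^const>\<open>undefined\<close> elsewhere, and the Borel
  structure is that of the library's finite products \<open>\<Pi>\<^sub>M\<close>.
\<close>

definition pos_cone :: "nat \<Rightarrow> (nat \<Rightarrow> real) set" where
  "pos_cone d = {x \<in> {1..d} \<rightarrow>\<^sub>E UNIV. \<forall>i\<in>{1..d}. 0 < x i}"

definition perm_cone :: "nat \<Rightarrow> (nat \<Rightarrow> nat) \<Rightarrow> (nat \<Rightarrow> real) set" where
  "perm_cone d \<pi> = {x \<in> pos_cone d. \<forall>i\<in>{1..<d}. x (\<pi> i) < x (\<pi> (Suc i))}"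

definition std_simplex :: "nat \<Rightarrow> (nat \<Rightarrow> real) set" where
  "std_simplex d = {x \<in> pos_cone d. (\<Sum>i\<in>{1..d}. x i) = 1}"

definition regular_simplex :: "nat \<Rightarrow> (nat \<Rightarrow> real) set" where
  "regular_simplex d = (\<Union>\<pi>\<in>{\<pi>. \<pi> permutes {1..d}}. perm_cone d \<pi> \<inter> std_simplex d)"

text \<open>
  For \<open>x\<close> in some \<open>perm_cone d \<pi>\<close>, the unique such \<open>\<pi>\<close> (lemma \<open>order_perm_eq\<close>);
  unspecified for vectors with two equal coordinates.
\<close>

definition order_perm :: "nat \<Rightarrow> (nat \<Rightarrow> real) \<Rightarrow> nat \<Rightarrow> nat" where
  "order_perm d x = (THE \<pi>. \<pi> permutes {1..d} \<and> x \<in> perm_cone d \<pi>)"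

definition brun :: "nat \<Rightarrow> (nat \<Rightarrow> real) \<Rightarrow> nat \<Rightarrow> real" where
  "brun d x = (let \<pi> = order_perm d x in x(\<pi> d := x (\<pi> d) - x (\<pi> (d - 1))))"

definition norm1 :: "nat \<Rightarrow> (nat \<Rightarrow> real) \<Rightarrow> real" where
  "norm1 d x = (\<Sum>i\<in>{1..d}. \<bar>x i\<bar>)"

text \<open>Meaningful on \<open>regular_simplex d\<close> only.\<close>

definition brun_proj :: "nat \<Rightarrow> (nat \<Rightarrow> real) \<Rightarrow> nat \<Rightarrow> real" where
  "brun_proj d x = (\<lambda>i\<in>{1..d}. brun d x i / norm1 d (brun d x))"

text \<open>
  The measure \<open>dx\<^sub>1 \<dots> dx\<^sub>d\<^sub>-\<^sub>1\<close> on the simplex: Lebesgue measure of the parameter domain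
  in \<open>\<real>\<^sup>d\<^sup>-\<^sup>1\<close>, pushed forward under \<open>x\<^sub>d = 1 - x\<^sub>1 - \<dots> - x\<^sub>d\<^sub>-\<^sub>1\<close>; lemma
  \<open>emeasure_simplex_lebesgue\<close> spells it out.
\<close>

definition simplex_lift :: "nat \<Rightarrow> (nat \<Rightarrow> real) \<Rightarrow> nat \<Rightarrow> real" where
  "simplex_lift d y = (\<lambda>i\<in>{1..d}. if i = d then 1 - (\<Sum>j\<in>{1..<d}. y j) else y i)"


definition simplex_borel :: "nat \<Rightarrow> (nat \<Rightarrow> real) measure" where
  "simplex_borel d = restrict_space (\<Pi>\<^sub>M i\<in>{1..d}. borel) (std_simplex d)"

definition simplex_lebesgue :: "nat \<Rightarrow> (nat \<Rightarrow> real) measure" where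
  "simplex_lebesgue d =
     distr (restrict_space (\<Pi>\<^sub>M i\<in>{1..<d}. lborel) {y. simplex_lift d y \<in> std_simplex d})
       (simplex_borel d) (simplex_lift d)"

definition brun_chains :: "nat \<Rightarrow> (nat \<Rightarrow> nat) \<Rightarrow> (nat \<Rightarrow> nat set) set" where
  "brun_chains d \<pi> =
     {A \<in> {1..d - 1} \<rightarrow>\<^sub>E Pow {1..d}.
        A 1 = {\<pi> (d - 1)} \<and> A (d - 1) = {1..d} - {\<pi> d} \<and>
        (\<forall>k\<in>{1..d - 1}. card (A k) = k) \<and>
        (\<forall>k\<in>{1..<d - 1}. A k \<subset> A (Suc k))}"

text \<open>The value \<open>0\<close> is a default off the set where the density is defined.\<close>

definition brun_density :: "nat \<Rightarrow> (nat \<Rightarrow> real) \<Rightarrow> real" where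
  "brun_density d x =
     (if x \<in> regular_simplex d then
        let \<pi> = order_perm d x in
          1 / (fact (d - 1) * x (\<pi> (d - 1))) *
          (\<Sum>A\<in>brun_chains d \<pi>. \<Prod>k\<in>{1..d - 1}. 1 / (1 - (\<Sum>i\<in>A k. x i)))
      else 0)"

definition brun_measure :: "nat \<Rightarrow> (nat \<Rightarrow> real) measure" where
  "brun_measure d = density (simplex_lebesgue d) (\<lambda>x. ennreal (brun_density d x))"

lemma order_perm_eq:
  assumes "\<pi> permutes {1..d}" and "x \<in> perm_cone d \<pi>"
  shows "order_perm d x = \<pi>"
proof -
  have sorted: "sorted (map (x \<circ> \<sigma>) [1..<Suc d]) \<and> distinct (map (x \<circ> \<sigma>) [1..<Suc d]) \<and>
      set (map (x \<circ> \<sigma>) [1..<Suc d]) = x ` {1..d} \<and> inj_on (x \<circ> \<sigma>) {1..d}"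
    if \<sigma>: "\<sigma> permutes {1..d}" "x \<in> perm_cone d \<sigma>" for \<sigma>
  proof -
    have step: "\<And>i. i \<in> {1..<d} \<Longrightarrow> x (\<sigma> i) < x (\<sigma> (Suc i))"
      using \<sigma>(2) by (simp add: perm_cone_def)
    have less: "x (\<sigma> i) < x (\<sigma> j)" if "1 \<le> i" "i < j" "j \<le> d" for i j
      using that(2,3)
    proof (induction j)
      case 0
      then show ?case by simp
    next
      case (Suc j)
      show ?case
      proof (cases "i = j")
        case True
        then show ?thesis using step[of j] Suc.prems \<open>1 \<le> i\<close> by simp
      next
        case False
        then have "x (\<sigma> i) < x (\<sigma> j)" using Suc by simp
        also have "\<dots> < x (\<sigma> (Suc j))" using step[of j] Suc.prems \<open>1 \<le> i\<close> by simp
        finally show ?thesis .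
      qed
    qed
    have inj: "inj_on (x \<circ> \<sigma>) {1..d}"
      by (rule linorder_inj_onI') (use less in fastforce)
    have "sorted (map (x \<circ> \<sigma>) [1..<Suc d])"
      unfolding sorted_iff_nth_mono_less using less by (force simp: less_imp_le simp del: upt_Suc)
    moreover have "set (map (x \<circ> \<sigma>) [1..<Suc d]) = x ` {1..d}"
      using permutes_image[OF \<sigma>(1)]
      by (metis (no_types) atLeastLessThanSuc_atLeastAtMost image_comp list.set_map set_upt)
    moreover have "distinct (map (x \<circ> \<sigma>) [1..<Suc d])"
      using inj by (simp add: distinct_map atLeastLessThanSuc_atLeastAtMost del: upt_Suc)
    ultimately show ?thesis using inj by blast
  qed
  have "\<sigma> = \<pi>" if \<sigma>: "\<sigma> permutes {1..d}" "x \<in> perm_cone d \<sigma>" for \<sigma>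
  proof -
    have "map (x \<circ> \<sigma>) [1..<Suc d] = map (x \<circ> \<pi>) [1..<Suc d]"
      using sorted[OF \<sigma>] sorted[OF assms] by (intro sorted_distinct_set_unique) auto
    then have eq: "x (\<sigma> i) = x (\<pi> i)" if "i \<in> {1..d}" for i
      using that by (auto simp: map_eq_conv simp del: upt_Suc)
    have "inj_on x (\<pi> ` {1..d})"
      using sorted[OF assms] by (auto intro: inj_on_imageI)
    then have inj: "inj_on x {1..d}" by (simp only: permutes_image[OF assms(1)])
    show ?thesis
    proof
      fix i
      show "\<sigma> i = \<pi> i"
      proof (cases "i \<in> {1..d}")
        case True
        then have "\<sigma> i \<in> {1..d}" "\<pi> i \<in> {1..d}"
          using permutes_in_image[OF \<sigma>(1)] permutes_in_image[OF assms(1)] by blast+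
        then show ?thesis using inj eq[OF True] by (rule inj_onD[rotated 2])
      next
        case False
        then show ?thesis using \<sigma>(1) assms(1) by (simp add: permutes_def)
      qed
    qed
  qed
  then show ?thesis
    unfolding order_perm_def using assms by blast
qed

lemma simplex_lift_measurable:
  "simplex_lift d \<in> (\<Pi>\<^sub>M i\<in>{1..<d}. lborel) \<rightarrow>\<^sub>M (\<Pi>\<^sub>M i\<in>{1..d}. borel)"
  unfolding simplex_lift_def
proof (rule measurable_restrict)
  fix i assume i: "i \<in> {1..d}"
  show "(\<lambda>y. if i = d then 1 - (\<Sum>j\<in>{1..<d}. y j) else y i)
      \<in> (\<Pi>\<^sub>M i\<in>{1..<d}. lborel) \<rightarrow>\<^sub>M (borel :: real measure)"
  proof (cases "i = d")
    case True
    have "(\<lambda>y. y j) \<in> (\<Pi>\<^sub>M i\<in>{1..<d}. lborel) \<rightarrow>\<^sub>M (borel :: real measure)" if "j \<in> {1..<d}" for j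
      using measurable_component_singleton[OF that, of "\<lambda>_. lborel :: real measure"] by simp
    then show ?thesis using True by (auto intro!: borel_measurable_diff borel_measurable_sum)
  next
    case False
    then have "i \<in> {1..<d}" using i by auto
    then show ?thesis
      using False measurable_component_singleton[of i "{1..<d}" "\<lambda>_. lborel :: real measure"]
      by simp
  qed
qed

lemma std_simplex_sets: "std_simplex d \<in> sets (\<Pi>\<^sub>M i\<in>{1..d}. borel)"
proof -
  have "std_simplex d = {x \<in> space (\<Pi>\<^sub>M i\<in>{1..d}. borel). (\<forall>i\<in>{1..d}. 0 < x i) \<and>
      (\<Sum>i\<in>{1..d}. x i) = 1}"
    by (auto simp: std_simplex_def pos_cone_def space_PiM)
  also have "\<dots> \<in> sets (\<Pi>\<^sub>M i\<in>{1..d}. borel)"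
    by measurable
  finally show ?thesis .
qed

lemma emeasure_simplex_lebesgue:
  assumes "B \<in> sets (simplex_borel d)"
  shows "emeasure (simplex_lebesgue d) B =
    emeasure (\<Pi>\<^sub>M i\<in>{1..<d}. lborel) {y \<in> {1..<d} \<rightarrow>\<^sub>E UNIV. simplex_lift d y \<in> B}"
proof -
  let ?P = "\<Pi>\<^sub>M i\<in>{1..<d}. lborel :: real measure"
  let ?D = "{y. simplex_lift d y \<in> std_simplex d}"
  have sub: "B \<subseteq> std_simplex d"
    using sets.sets_into_space[OF assms] by (auto simp: simplex_borel_def space_restrict_space)
  have D: "?D \<inter> space ?P \<in> sets ?P"
    using measurable_sets[OF simplex_lift_measurable std_simplex_sets, of d]
    by (simp add: vimage_def)
  have "simplex_lift d \<in> restrict_space ?P ?D \<rightarrow>\<^sub>M simplex_borel d"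
    unfolding simplex_borel_def
    by (intro measurable_restrict_space2 measurable_restrict_space1 simplex_lift_measurable)
      (auto simp: space_restrict_space)
  then have "emeasure (simplex_lebesgue d) B =
      emeasure (restrict_space ?P ?D) (simplex_lift d -` B \<inter> space (restrict_space ?P ?D))"
    using assms unfolding simplex_lebesgue_def by (rule emeasure_distr)
  also have "\<dots> = emeasure ?P (simplex_lift d -` B \<inter> space (restrict_space ?P ?D))"
    using D by (intro emeasure_restrict_space) (auto simp: space_restrict_space)
  also have "simplex_lift d -` B \<inter> space (restrict_space ?P ?D) =
      {y \<in> {1..<d} \<rightarrow>\<^sub>E UNIV. simplex_lift d y \<in> B}"
    using sub by (auto simp: space_restrict_space space_PiM)
  finally show ?thesis .
qed

end

theory Submission
  imports Defs
begin

text \<open>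
  The density is the restriction to the simplex of a function \<open>h\<close> on the positive cone that is
  homogeneous of degree \<open>-d\<close>. Two facts make it invariant.

  First, \<open>h dx\<close> is invariant under the linear, non-projective algorithm. A point \<open>y\<close> with distinct
  coordinates has \<open>d\<close> preimages: for each position \<open>i\<close>, add to coordinate \<open>i\<close> the maximum of the other
  coordinates. Each inverse branch is a shear and has Jacobian 1, so the claim is that \<open>h y\<close> is
  the sum of \<open>h\<close> over the preimages (\<open>cone_density_invariant\<close>). Written with the complements of the sets
  \<open>A\<^sub>k\<close>, all terms are sums over descending chains of index sets, weighted by the reciprocals of the
  partial coordinate sums. Let \<open>m\<close> and \<open>p\<close> be the positions of the largest and the second largest
  coordinate of \<open>y\<close>. The branches with \<open>i \<noteq> m\<close> together give the chains from the full set down to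
  \<open>{m}\<close>, and the branch with \<open>i = m\<close> gives the chains down to \<open>{m, p}\<close>. That they add up,
  with the leading factors taken into account, to the chains from the complement of \<open>p\<close> down to
  \<open>{m}\<close>, which are those of \<open>h y\<close>, is a short induction
  (\<open>chain_sum_exchange\<close>).

  Second, invariance on the cone descends to the simplex. If \<open>g\<close> is homogeneous of degree \<open>-d\<close>, then
  integrating \<open>g\<close> over the simplex is the same as integrating it over the cone against a cut-off
  function of any positive homogeneous gauge \<open>N\<close> of degree 1
  (\<open>nn_integral_simplex_eq_cone\<close>). For the integral over the preimage of a set the gauge is the norm of the
  image point \<open>F x\<close>, so that the integrand is \<open>h x\<close> times a function of \<open>F x\<close>; the invariance of \<open>h dx\<close>
  turns it into the integral with the norm of \<open>x\<close> itself as gauge, which is the integral over the set.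
  In this way the Jacobian of the projective map never has to be computed.

  Points with two equal coordinates, where the density is 0 by convention, form a null set
  (\<open>AE_distinct_coords\<close>).
\<close>

section \<open>Sums over chains of sets\<close>

text \<open>
  \<open>chain_sum w n R S\<close> is the sum of \<open>w C\<^sub>0 * \<dots> * w C\<^sub>n\<close> over all chains
  \<open>S = C\<^sub>0 \<supset> C\<^sub>1 \<supset> \<dots> \<supset> C\<^sub>n \<supseteq> R\<close> that lose one element at a time. It is applied with
  \<open>card S = card R + n\<close>, which forces \<open>C\<^sub>n = R\<close>. The sets of the chains are the
  complements of the sets \<open>A\<^sub>k\<close> of the density formula, because there the factor of \<open>A\<^sub>k\<close> is
  the reciprocal of the sum of the coordinates outside \<open>A\<^sub>k\<close>.
\<close>

primrec chain_sum :: "('a set \<Rightarrow> real) \<Rightarrow> nat \<Rightarrow> 'a set \<Rightarrow> 'a set \<Rightarrow> real" where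
  "chain_sum w 0 R S = w S"
| "chain_sum w (Suc n) R S = w S * (\<Sum>a\<in>S - R. chain_sum w n R (S - {a}))"

lemma chain_sum_scale:
  "chain_sum (\<lambda>B. c * w B) n R S = c ^ Suc n * chain_sum w n R S"
  by (induction n arbitrary: S) (simp_all add: sum_distrib_left mult_ac)

text \<open>
  Adjoining a new element to every member is a bijection of chains. A preimage of a point under
  the Brun algorithm has one coordinate enlarged by another one, so its weights are the weights of
  the point itself at sets with one more element.
\<close>

lemma chain_sum_adjoin:
  assumes "q \<notin> S" "R \<subseteq> S"
    and "\<And>B. R \<subseteq> B \<Longrightarrow> B \<subseteq> S \<Longrightarrow> v B = w (insert q B)"
  shows "chain_sum v n R S = chain_sum w n (insert q R) (insert q S)"
  using assms
proof (induction n arbitrary: S)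
  case (Suc n)
  have "chain_sum v n R (S - {a}) = chain_sum w n (insert q R) (insert q S - {a})"
    if a: "a \<in> S - R" for a
  proof -
    have "chain_sum v n R (S - {a}) = chain_sum w n (insert q R) (insert q (S - {a}))"
      using Suc.prems a by (intro Suc.IH) auto
    also have "insert q (S - {a}) = insert q S - {a}" using Suc.prems a by auto
    finally show ?thesis .
  qed
  moreover have "insert q S - insert q R = S - R" using Suc.prems by auto
  ultimately show ?case using Suc.prems by simp
qed simp

text \<open>
  Classifying the chains by their smallest member but one, instead of the largest but one as in
  the recursion.
\<close>

lemma chain_sum_bottom:
  assumes "finite S" "R \<subseteq> S" "card S = card R + Suc n"
  shows "chain_sum w (Suc n) R S = w R * (\<Sum>i\<in>S - R. chain_sum w n (insert i R) S)"
  using assms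
proof (induction n arbitrary: S)
  case 0
  then have "card (S - R) = 1" by (simp add: card_Diff_subset finite_subset)
  then obtain a where a: "S - R = {a}" by (auto simp: card_1_singleton_iff)
  then have "S - {a} = R" using 0 by auto
  then show ?case using a by simp
next
  case (Suc n)
  have fin: "finite (S - R)" using Suc.prems by simp
  have IH: "chain_sum w (Suc n) R (S - {a}) =
      w R * (\<Sum>i\<in>S - R - {a}. chain_sum w n (insert i R) (S - {a}))" if a: "a \<in> S - R" for a
  proof -
    have "S - {a} - R = S - R - {a}" by auto
    then show ?thesis using Suc.IH[of "S - {a}"] Suc.prems a by auto
  qed
  have "chain_sum w (Suc (Suc n)) R S =
      w S * (\<Sum>a\<in>S - R. w R * (\<Sum>i\<in>S - R - {a}. chain_sum w n (insert i R) (S - {a})))"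
    using IH by (simp del: chain_sum.simps(2) add: chain_sum.simps(2)[of w "Suc n"])
  also have "\<dots> = w R * (w S * (\<Sum>a\<in>S - R. \<Sum>i\<in>S - R - {a}. chain_sum w n (insert i R) (S - {a})))"
    by (simp add: sum_distrib_left mult_ac)
  also have "(\<Sum>a\<in>S - R. \<Sum>i\<in>S - R - {a}. chain_sum w n (insert i R) (S - {a})) =
      (\<Sum>i\<in>S - R. \<Sum>a\<in>S - insert i R. chain_sum w n (insert i R) (S - {a}))"
  proof -
    have "S - R - {a} = {i \<in> S - R. i \<noteq> a}" for a by auto
    moreover have "S - insert i R = {a \<in> S - R. i \<noteq> a}" for i by auto
    ultimately show ?thesis using sum.swap_restrict[OF fin fin] by simp
  qed
  also have "w S * \<dots> = (\<Sum>i\<in>S - R. chain_sum w (Suc n) (insert i R) S)"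
    by (simp add: sum_distrib_left)
  finally show ?case .
qed

definition recip_sum :: "('a \<Rightarrow> real) \<Rightarrow> 'a set \<Rightarrow> real" where
  "recip_sum y B = 1 / (\<Sum>b\<in>B. y b)"

text \<open>
  The algebraic core of the invariance. The left-hand side belongs to a point \<open>y\<close> with largest
  coordinate \<open>m\<close> and second largest coordinate \<open>p\<close>; the two terms on the right belong to its
  preimages. Multiplying by the sum over \<open>S\<close> and peeling off the top set of every chain turns the
  right-hand side into
  \<open>y p * X + (\<Sum>a\<in>S - {m, p}. chain_sum _ n {m} (S - {p} - {a}))\<close>, where \<open>X\<close> is the left-hand
  side and the induction hypothesis has been used for each \<open>S - {a}\<close>. By the recursion, the last
  sum is \<open>X\<close> times the sum of \<open>y\<close> over \<open>S - {p}\<close>.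
\<close>

lemma chain_sum_exchange:
  assumes "finite S" "m \<in> S" "p \<in> S" "m \<noteq> p" "card S = n + 2" "\<And>s. s \<in> S \<Longrightarrow> 0 < y s"
  shows "chain_sum (recip_sum y) n {m} (S - {p}) =
    y p * chain_sum (recip_sum y) (Suc n) {m} S + chain_sum (recip_sum y) n {m, p} S"
  using assms
proof (induction n arbitrary: S)
  case 0
  have "{m, p} = S" using 0 by (intro card_subset_eq) auto
  then have S: "S = {m, p}" ..
  have "S - {p} = {m}" "S - {m} = {p}" using S 0 by auto
  moreover have "0 < y m" "0 < y p" using 0 by auto
  then have "y p / ((y m + y p) * y m) + 1 / (y m + y p) = 1 / y m"
    by (simp add: divide_simps)
  ultimately show ?case using \<open>m \<noteq> p\<close> by (simp add: recip_sum_def S)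
next
  case (Suc n)
  let ?K = "chain_sum (recip_sum y)"
  let ?X = "?K (Suc n) {m} (S - {p})"
  let ?I = "S - {m, p}"
  have I: "S - {m} = insert p ?I" "S - {p} - {m} = ?I" "finite ?I" "p \<notin> ?I"
    using Suc.prems by auto
  have pos: "0 < sum y S" "0 < sum y (S - {p})"
    using Suc.prems by (auto intro!: sum_pos)
  have split: "sum y S = y p + sum y (S - {p})"
    using Suc.prems(1,3) by (rule sum.remove)
  have IH: "y p * ?K (Suc n) {m} (S - {a}) + ?K n {m, p} (S - {a}) = ?K n {m} (S - {p} - {a})"
    if a: "a \<in> ?I" for a
  proof -
    have "S - {a} - {p} = S - {p} - {a}" by auto
    then show ?thesis using Suc.IH[of "S - {a}"] Suc.prems a by auto
  qed
  have X: "(\<Sum>a\<in>?I. ?K n {m} (S - {p} - {a})) = sum y (S - {p}) * ?X"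
    using pos by (simp add: I(2) recip_sum_def)
  have "y p * ?K (Suc (Suc n)) {m} S + ?K (Suc n) {m, p} S =
      recip_sum y S * (y p * (?X + (\<Sum>a\<in>?I. ?K (Suc n) {m} (S - {a}))) + (\<Sum>a\<in>?I. ?K n {m, p} (S - {a})))"
    using I by (simp del: chain_sum.simps(2) add: chain_sum.simps(2)[of _ "Suc n"]
        chain_sum.simps(2)[of _ n _ S] algebra_simps)
  also have "y p * (?X + (\<Sum>a\<in>?I. ?K (Suc n) {m} (S - {a}))) + (\<Sum>a\<in>?I. ?K n {m, p} (S - {a})) =
      y p * ?X + (\<Sum>a\<in>?I. y p * ?K (Suc n) {m} (S - {a}) + ?K n {m, p} (S - {a}))"
    by (simp only: distrib_left sum.distrib sum_distrib_left add.assoc)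
  also have "\<dots> = y p * ?X + sum y (S - {p}) * ?X"
    using IH X by simp
  also have "\<dots> = sum y S * ?X" using split by (simp add: algebra_simps)
  also have "recip_sum y S * \<dots> = ?X" using pos by (simp add: recip_sum_def)
  finally show ?case ..
qed

text \<open>
  The chains in the indexed form in which they occur in the density. The size condition is
  \<open>card (A k) = card P + k - 1\<close>, written without truncated subtraction.
\<close>

definition set_chains :: "'a set \<Rightarrow> nat \<Rightarrow> 'a set \<Rightarrow> 'a set \<Rightarrow> (nat \<Rightarrow> 'a set) set" where
  "set_chains U n P T = {A \<in> {1..Suc n} \<rightarrow>\<^sub>E Pow U. A 1 = P \<and> A (Suc n) = T \<and>
      (\<forall>k\<in>{1..Suc n}. Suc (card (A k)) = card P + k) \<and> (\<forall>k\<in>{1..n}. A k \<subset> A (Suc k))}"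

lemma set_chains_subset_top:
  assumes "A \<in> set_chains U n P T" "k \<in> {1..Suc n}"
  shows "A k \<subseteq> T"
proof -
  have "k \<le> Suc n" using assms by simp
  then have "A k \<subseteq> A (Suc n)"
  proof (induction rule: inc_induct)
    case (step l)
    then have "A l \<subset> A (Suc l)" using assms by (simp add: set_chains_def)
    then show ?case using step by blast
  qed simp
  then show ?thesis using assms by (simp add: set_chains_def)
qed

text \<open>
  The recursion of \<^const>\<open>chain_sum\<close> for indexed chains: dropping the first set of a chain from
  \<open>P\<close> to \<open>T\<close> leaves a chain from \<open>insert a P\<close> to \<open>T\<close> for a unique \<open>a\<close>.
\<close>

lemma sum_set_chains:
  assumes "finite U" "T \<subseteq> U" "P \<subseteq> T" "card T = card P + n"
  shows "(\<Sum>A\<in>set_chains U n P T. \<Prod>k\<in>{1..Suc n}. w (U - A k)) = chain_sum w n (U - T) (U - P)"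
  using assms(3-)
proof (induction n arbitrary: P)
  case 0
  have "P = T" using 0 assms by (intro card_subset_eq) (auto intro: finite_subset)
  then have "set_chains U 0 P T = {\<lambda>k\<in>{1}. P}"
    using assms(2) by (auto simp: set_chains_def PiE_iff extensional_def fun_eq_iff)
  then show ?case by simp
next
  case (Suc n)
  have finP: "finite P" "finite T" "P \<subseteq> U" using Suc.prems assms by (auto intro: finite_subset)
  have card_insert: "card (insert a P) = Suc (card P)" if "a \<in> T - P" for a
    using that finP by simp
  have fin: "finite (set_chains U n Q T)" for Q
    by (rule finite_subset[OF _ finite_PiE[of "{1..Suc n}" "\<lambda>_. Pow U"]])
      (use assms in \<open>auto simp: set_chains_def\<close>)
  let ?sh = "\<lambda>A. \<lambda>k\<in>{1..Suc n}. A (Suc k)"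
  let ?un = "\<lambda>A. \<lambda>k\<in>{1..Suc (Suc n)}. if k = 1 then P else A (k - 1)"
  let ?UN = "\<Union>a\<in>T - P. set_chains U n (insert a P) T"
  have sh: "?sh A \<in> ?UN" if A: "A \<in> set_chains U (Suc n) P T" for A
  proof -
    have cA: "A \<in> {1..Suc (Suc n)} \<rightarrow>\<^sub>E Pow U" "A 1 = P" "A (Suc (Suc n)) = T"
      "\<And>k. k \<in> {1..Suc (Suc n)} \<Longrightarrow> Suc (card (A k)) = card P + k"
      "\<And>k. k \<in> {1..Suc n} \<Longrightarrow> A k \<subset> A (Suc k)"
      using A by (auto simp: set_chains_def)
    have A2: "P \<subset> A 2" "card (A 2) = Suc (card P)" "A 2 \<subseteq> T" "finite (A 2)"
      using cA(5)[of 1] cA(4)[of 2] cA(2) set_chains_subset_top[OF A, of 2] finP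
      by (auto simp: numeral_2_eq_2 intro: finite_subset)
    then have "card (A 2 - P) = 1" using finP by (simp add: card_Diff_subset)
    then obtain a where a: "A 2 - P = {a}" by (auto simp: card_1_singleton_iff)
    then have ins: "A 2 = insert a P" "a \<in> T - P" using A2 by auto
    have "?sh A k \<subset> ?sh A (Suc k)" if "k \<in> {1..n}" for k
      using that cA(5)[of "Suc k"] by simp
    moreover have "Suc (card (?sh A k)) = card (insert a P) + k" if "k \<in> {1..Suc n}" for k
      using that cA(4)[of "Suc k"] card_insert[OF ins(2)] by simp
    moreover have "?sh A \<in> {1..Suc n} \<rightarrow>\<^sub>E Pow U"
    proof (rule PiE_I)
      fix k assume "k \<in> {1..Suc n}"
      then show "?sh A k \<in> Pow U" using PiE_mem[OF cA(1), of "Suc k"] by simp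
    qed (simp only: restrict_def if_False)
    moreover have "?sh A 1 = insert a P" "?sh A (Suc n) = T"
      using ins cA(3) by (simp_all add: numeral_2_eq_2)
    ultimately have "?sh A \<in> set_chains U n (insert a P) T"
      unfolding set_chains_def by blast
    then show ?thesis using ins by auto
  qed
  have un: "?un A \<in> set_chains U (Suc n) P T" if A: "A \<in> ?UN" for A
  proof -
    obtain a where a: "a \<in> T - P" "A \<in> set_chains U n (insert a P) T" using A by auto
    have cA: "A \<in> {1..Suc n} \<rightarrow>\<^sub>E Pow U" "A 1 = insert a P" "A (Suc n) = T"
      "\<And>k. k \<in> {1..Suc n} \<Longrightarrow> Suc (card (A k)) = Suc (card P) + k"
      "\<And>k. k \<in> {1..n} \<Longrightarrow> A k \<subset> A (Suc k)"
      using a card_insert[OF a(1)] by (auto simp: set_chains_def)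
    have "?un A k \<subset> ?un A (Suc k)" if "k \<in> {1..Suc n}" for k
    proof (cases "k = 1")
      case True
      then show ?thesis using cA(2) a(1) by auto
    next
      case False
      then have "k = Suc (k - 1)" "k - 1 \<in> {1..n}" using that by auto
      then obtain l where "k = Suc l" "l \<in> {1..n}" by blast
      then show ?thesis using cA(5)[of l] by simp
    qed
    moreover have "Suc (card (?un A k)) = card P + k" if "k \<in> {1..Suc (Suc n)}" for k
    proof (cases "k = 1")
      case False
      then have "k = Suc (k - 1)" "k - 1 \<in> {1..Suc n}" using that by auto
      then obtain l where "k = Suc l" "l \<in> {1..Suc n}" by blast
      then show ?thesis using cA(4)[of l] by simp
    qed simp
    moreover have "?un A \<in> {1..Suc (Suc n)} \<rightarrow>\<^sub>E Pow U"
    proof (rule PiE_I)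
      fix k assume k: "k \<in> {1..Suc (Suc n)}"
      show "?un A k \<in> Pow U"
      proof (cases "k = 1")
        case False
        then have "k = Suc (k - 1)" "k - 1 \<in> {1..Suc n}" using k by auto
        then obtain l where "k = Suc l" "l \<in> {1..Suc n}" by blast
        then show ?thesis using PiE_mem[OF cA(1), of l] by simp
      qed (use finP in simp)
    qed (simp only: restrict_def if_False)
    moreover have "?un A 1 = P" "?un A (Suc (Suc n)) = T"
      using cA(3) by simp_all
    ultimately show ?thesis unfolding set_chains_def by blast
  qed
  have "(\<Sum>A\<in>set_chains U (Suc n) P T. \<Prod>k\<in>{1..Suc (Suc n)}. w (U - A k)) =
      (\<Sum>A\<in>?UN. w (U - P) * (\<Prod>k\<in>{1..Suc n}. w (U - A k)))"
  proof (rule sum.reindex_bij_witness[of _ ?un ?sh])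
    show "?sh A \<in> ?UN" if "A \<in> set_chains U (Suc n) P T" for A by (rule sh[OF that])
    show "?un A \<in> set_chains U (Suc n) P T" if "A \<in> ?UN" for A by (rule un[OF that])
    show "?un (?sh A) = A" if "A \<in> set_chains U (Suc n) P T" for A
      using that by (auto simp: set_chains_def PiE_iff extensional_def fun_eq_iff)
    show "?sh (?un A) = A" if "A \<in> ?UN" for A
      using that by (auto simp: set_chains_def PiE_iff extensional_def fun_eq_iff)
    show "w (U - P) * (\<Prod>k\<in>{1..Suc n}. w (U - ?sh A k)) = (\<Prod>k\<in>{1..Suc (Suc n)}. w (U - A k))"
      if "A \<in> set_chains U (Suc n) P T" for A
    proof -
      have "(\<Prod>k\<in>{1..Suc (Suc n)}. w (U - A k)) = w (U - A 1) * (\<Prod>k\<in>{2..Suc (Suc n)}. w (U - A k))"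
        by (subst prod.atLeast_Suc_atMost) (auto simp: numeral_2_eq_2)
      also have "(\<Prod>k\<in>{2..Suc (Suc n)}. w (U - A k)) = (\<Prod>k\<in>{1..Suc n}. w (U - A (Suc k)))"
        using prod.shift_bounds_cl_Suc_ivl[of "\<lambda>k. w (U - A k)" 1 "Suc n"] by (simp add: numeral_2_eq_2)
      also have "A 1 = P" using that by (simp add: set_chains_def)
      also have "(\<Prod>k\<in>{1..Suc n}. w (U - A (Suc k))) = (\<Prod>k\<in>{1..Suc n}. w (U - ?sh A k))"
        by (intro prod.cong) simp_all
      finally show ?thesis ..
    qed
  qed
  also have "\<dots> = (\<Sum>a\<in>T - P. \<Sum>A\<in>set_chains U n (insert a P) T. w (U - P) * (\<Prod>k\<in>{1..Suc n}. w (U - A k)))"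
  proof (intro sum.UNION_disjoint ballI impI fin)
    show "finite (T - P)" using finP by simp
    fix a b assume "a \<in> T - P" "b \<in> T - P" "a \<noteq> b"
    then have "insert a P \<noteq> insert b P" by blast
    then show "set_chains U n (insert a P) T \<inter> set_chains U n (insert b P) T = {}"
      by (auto simp: set_chains_def)
  qed
  also have "\<dots> = (\<Sum>a\<in>T - P. w (U - P) * chain_sum w n (U - T) (U - insert a P))"
  proof (intro sum.cong refl)
    fix a assume a: "a \<in> T - P"
    have "(\<Sum>A\<in>set_chains U n (insert a P) T. \<Prod>k\<in>{1..Suc n}. w (U - A k)) =
        chain_sum w n (U - T) (U - insert a P)"
      using Suc.prems a card_insert[OF a] by (intro Suc.IH) auto
    then show "(\<Sum>A\<in>set_chains U n (insert a P) T. w (U - P) * (\<Prod>k\<in>{1..Suc n}. w (U - A k))) =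
        w (U - P) * chain_sum w n (U - T) (U - insert a P)"
      by (simp only: sum_distrib_left[symmetric])
  qed
  also have "\<dots> = w (U - P) * (\<Sum>a\<in>(U - P) - (U - T). chain_sum w n (U - T) (U - P - {a}))"
  proof -
    have "(U - P) - (U - T) = T - P" using assms(2) by auto
    moreover have "U - insert a P = U - P - {a}" for a by auto
    ultimately show ?thesis by (simp add: sum_distrib_left)
  qed
  finally show ?case by simp
qed

section \<open>Lebesgue measure on the cone and on the simplex\<close>

abbreviation lebesgue_prod :: "'i set \<Rightarrow> ('i \<Rightarrow> real) measure" where
  "lebesgue_prod I \<equiv> (\<Pi>\<^sub>M i\<in>I. lborel)"

interpretation lebesgue_prod: product_sigma_finite "\<lambda>_. lborel :: real measure"
  by standard

lemma measurable_coord: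
  "i \<in> I \<Longrightarrow> (\<lambda>x. x i) \<in> borel_measurable (lebesgue_prod I)"
  using measurable_component_singleton[of i I "\<lambda>_. lborel :: real measure"] by simp

lemma measurable_into_lebesgue_prod:
  assumes "\<And>i. i \<in> I \<Longrightarrow> (\<lambda>x. f x i) \<in> borel_measurable M"
    and "\<And>x. x \<in> space M \<Longrightarrow> f x \<in> extensional I"
  shows "f \<in> M \<rightarrow>\<^sub>M lebesgue_prod I"
proof (rule measurable_PiM_single')
  show "f \<in> space M \<rightarrow> (\<Pi>\<^sub>E i\<in>I. space lborel)"
    using assms(2) by (auto simp: PiE_def)
qed (use assms(1) in simp)

lemma measurable_coord_update:
  assumes "i \<in> I" and f: "f \<in> borel_measurable (lebesgue_prod I)"
  shows "(\<lambda>x. x(i := f x)) \<in> lebesgue_prod I \<rightarrow>\<^sub>M lebesgue_prod I"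
proof (rule measurable_into_lebesgue_prod)
  show "(\<lambda>x. (x(i := f x)) k) \<in> borel_measurable (lebesgue_prod I)" if "k \<in> I" for k
    using that f by (cases "k = i") simp_all
qed (use assms in \<open>auto simp: space_PiM PiE_def extensional_def\<close>)

lemma measurable_insert_coord:
  assumes f: "f \<in> borel_measurable (lebesgue_prod I)"
  shows "(\<lambda>x. x(i := f x)) \<in> lebesgue_prod I \<rightarrow>\<^sub>M lebesgue_prod (insert i I)"
proof (rule measurable_into_lebesgue_prod)
  show "(\<lambda>x. (x(i := f x)) k) \<in> borel_measurable (lebesgue_prod I)" if "k \<in> insert i I" for k
    using that f by (cases "k = i") simp_all
qed (auto simp: space_PiM PiE_def extensional_def)

lemma measurable_section:
  assumes "x \<in> space (lebesgue_prod I)"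
  shows "(\<lambda>t. x(i := t)) \<in> borel \<rightarrow>\<^sub>M lebesgue_prod (insert i I)"
proof (rule measurable_into_lebesgue_prod)
  show "(\<lambda>t. (x(i := t)) k) \<in> borel_measurable borel" for k
    by (cases "k = i") simp_all
qed (use assms in \<open>auto simp: space_PiM PiE_def extensional_def\<close>)

text \<open>
  By Fubini, a map that changes a single coordinate affinely, with a translation depending on the
  other coordinates, scales Lebesgue measure by the factor of that coordinate. These shears and
  dilations are the only changes of variables in the whole proof.
\<close>

lemma nn_integral_affine_coord:
  fixes c :: "('i \<Rightarrow> real) \<Rightarrow> real"
  assumes I: "finite I" "i \<in> I" and r: "r \<noteq> 0"
    and g [measurable]: "g \<in> borel_measurable (lebesgue_prod I)"
    and c [measurable]: "c \<in> borel_measurable (lebesgue_prod I)"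
    and indep: "\<And>x t. c (x(i := t)) = c x"
  shows "(\<integral>\<^sup>+x. g x \<partial>lebesgue_prod I) = ennreal \<bar>r\<bar> * (\<integral>\<^sup>+x. g (x(i := c x + r * x i)) \<partial>lebesgue_prod I)"
proof -
  define J where "J = I - {i}"
  have J: "finite J" "i \<notin> J" "insert i J = I" using I by (auto simp: J_def)
  have "(\<lambda>x. x(i := c x + r * x i)) \<in> lebesgue_prod I \<rightarrow>\<^sub>M lebesgue_prod I"
    using I by (intro measurable_coord_update) simp_all
  note g_affine [measurable] = measurable_compose[OF this g]
  have slice: "(\<lambda>t. g (x(i := t))) \<in> borel_measurable borel" if "x \<in> space (lebesgue_prod J)" for x
    using measurable_compose[OF measurable_section[OF that] g[folded J(3)]] .
  have slice_affine: "(\<lambda>t. g (x(i := c x + r * t))) \<in> borel_measurable borel"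
    if "x \<in> space (lebesgue_prod J)" for x
    by (rule measurable_compose[OF _ slice[OF that]]) simp
  have "(\<integral>\<^sup>+x. g x \<partial>lebesgue_prod I) = (\<integral>\<^sup>+x. (\<integral>\<^sup>+t. g (x(i := t)) \<partial>lborel) \<partial>lebesgue_prod J)"
    using lebesgue_prod.product_nn_integral_insert[OF J(1,2), of g] J(3) by simp
  also have "\<dots> = (\<integral>\<^sup>+x. ennreal \<bar>r\<bar> * (\<integral>\<^sup>+t. g (x(i := c x + r * t)) \<partial>lborel) \<partial>lebesgue_prod J)"
  proof (rule nn_integral_cong)
    fix x assume x: "x \<in> space (lebesgue_prod J)"
    show "(\<integral>\<^sup>+t. g (x(i := t)) \<partial>lborel) = ennreal \<bar>r\<bar> * (\<integral>\<^sup>+t. g (x(i := c x + r * t)) \<partial>lborel)"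
      using r slice[OF x] by (rule nn_integral_real_affine[rotated])
  qed
  also have "\<dots> = (\<integral>\<^sup>+x. (\<integral>\<^sup>+t. ennreal \<bar>r\<bar> * g (x(i := c x + r * t)) \<partial>lborel) \<partial>lebesgue_prod J)"
  proof (rule nn_integral_cong)
    fix x assume x: "x \<in> space (lebesgue_prod J)"
    show "ennreal \<bar>r\<bar> * (\<integral>\<^sup>+t. g (x(i := c x + r * t)) \<partial>lborel) =
        (\<integral>\<^sup>+t. ennreal \<bar>r\<bar> * g (x(i := c x + r * t)) \<partial>lborel)"
      using slice_affine[OF x] by (intro nn_integral_cmult[symmetric]) simp
  qed
  also have "\<dots> = (\<integral>\<^sup>+x. ennreal \<bar>r\<bar> * g (x(i := c x + r * x i)) \<partial>lebesgue_prod I)"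
    using lebesgue_prod.product_nn_integral_insert[OF J(1,2), of "\<lambda>x. ennreal \<bar>r\<bar> * g (x(i := c x + r * x i))"] J(3)
    by (simp add: indep)
  also have "\<dots> = ennreal \<bar>r\<bar> * (\<integral>\<^sup>+x. g (x(i := c x + r * x i)) \<partial>lebesgue_prod I)"
    by (rule nn_integral_cmult) measurable
  finally show ?thesis .
qed

lemma nn_integral_dilate:
  fixes I :: "'i set"
  assumes "finite I" and g: "g \<in> borel_measurable (lebesgue_prod I)" and r: "0 < r"
  shows "(\<integral>\<^sup>+x. g x \<partial>lebesgue_prod I) =
    ennreal (r ^ card I) * (\<integral>\<^sup>+x. g (\<lambda>i\<in>I. r * x i) \<partial>lebesgue_prod I)"
proof -
  define D where "D J = (\<lambda>(x :: 'i \<Rightarrow> real) k. if k \<in> J then r * x k else x k)" for J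
  have D: "D J \<in> lebesgue_prod I \<rightarrow>\<^sub>M lebesgue_prod I" if "J \<subseteq> I" for J
  proof (rule measurable_into_lebesgue_prod)
    show "(\<lambda>x. D J x k) \<in> borel_measurable (lebesgue_prod I)" if "k \<in> I" for k
      using that by (cases "k \<in> J") (simp_all add: D_def)
  qed (use that in \<open>auto simp: D_def space_PiM PiE_def extensional_def\<close>)
  have "(\<integral>\<^sup>+x. g x \<partial>lebesgue_prod I) = ennreal (r ^ card J) * (\<integral>\<^sup>+x. g (D J x) \<partial>lebesgue_prod I)"
    if "J \<subseteq> I" for J
    using finite_subset[OF that assms(1)] that
  proof (induction J rule: finite_induct)
    case empty
    then show ?case by (simp add: D_def)
  next
    case (insert i J)
    have [measurable]: "(\<lambda>x. g (D J x)) \<in> borel_measurable (lebesgue_prod I)"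
      using measurable_compose[OF D g] insert.prems by auto
    have "(\<integral>\<^sup>+x. g (D J x) \<partial>lebesgue_prod I) = ennreal r * (\<integral>\<^sup>+x. g (D J (x(i := 0 + r * x i))) \<partial>lebesgue_prod I)"
      using nn_integral_affine_coord[of I i r "\<lambda>x. g (D J x)" "\<lambda>_. 0"] assms(1) r insert.prems by simp
    moreover have "D J (x(i := 0 + r * x i)) = D (insert i J) x" for x
      using insert.hyps by (auto simp: D_def fun_eq_iff)
    moreover have "ennreal (r ^ card (insert i J)) = ennreal (r ^ card J) * ennreal r"
      using insert.hyps r by (simp add: ennreal_mult[symmetric] mult.commute)
    ultimately show ?case using insert by (simp add: mult.assoc)
  qed
  from this[of I] have "(\<integral>\<^sup>+x. g x \<partial>lebesgue_prod I) = ennreal (r ^ card I) * (\<integral>\<^sup>+x. g (D I x) \<partial>lebesgue_prod I)"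
    by simp
  also have "(\<integral>\<^sup>+x. g (D I x) \<partial>lebesgue_prod I) = (\<integral>\<^sup>+x. g (\<lambda>i\<in>I. r * x i) \<partial>lebesgue_prod I)"
  proof (rule nn_integral_cong)
    fix x assume "x \<in> space (lebesgue_prod I)"
    then have "D I x = (\<lambda>i\<in>I. r * x i)" by (auto simp: D_def space_PiM PiE_def extensional_def fun_eq_iff)
    then show "g (D I x) = g (\<lambda>i\<in>I. r * x i)" by simp
  qed
  finally show ?thesis .
qed

lemma sum_simplex_lift: "1 \<le> d \<Longrightarrow> (\<Sum>i\<in>{1..d}. simplex_lift d y i) = 1"
proof -
  assume "1 \<le> d"
  then have "{1..d} = insert d {1..<d}" by auto
  then show ?thesis by (simp add: simplex_lift_def)
qed

lemma nn_integral_simplex_lebesgue: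
  assumes g: "g \<in> borel_measurable (simplex_borel d)"
  shows "(\<integral>\<^sup>+x. g x \<partial>simplex_lebesgue d) =
    (\<integral>\<^sup>+y. g (simplex_lift d y) * indicator (std_simplex d) (simplex_lift d y) \<partial>lebesgue_prod {1..<d})"
proof -
  let ?P = "lebesgue_prod {1..<d}"
  let ?D = "{y. simplex_lift d y \<in> std_simplex d}"
  have D: "?D \<inter> space ?P \<in> sets ?P"
    using measurable_sets[OF simplex_lift_measurable std_simplex_sets, of d]
    by (simp add: vimage_def)
  have lift: "simplex_lift d \<in> restrict_space ?P ?D \<rightarrow>\<^sub>M simplex_borel d"
    unfolding simplex_borel_def
    by (intro measurable_restrict_space2 measurable_restrict_space1 simplex_lift_measurable)
      (auto simp: space_restrict_space)
  have "(\<integral>\<^sup>+x. g x \<partial>simplex_lebesgue d) = (\<integral>\<^sup>+y. g (simplex_lift d y) \<partial>restrict_space ?P ?D)"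
    unfolding simplex_lebesgue_def using g by (intro nn_integral_distr[OF lift]) simp
  also have "\<dots> = (\<integral>\<^sup>+y. g (simplex_lift d y) * indicator ?D y \<partial>?P)"
    by (rule nn_integral_restrict_space[OF D])
  finally show ?thesis by (simp add: indicator_def)
qed

text \<open>
  A cut-off along rays. For the scale-invariant measure \<open>dr / r\<close> it has integral 1, and hence so
  does \<open>r \<mapsto> unit_window (r * a)\<close> for every \<open>a > 0\<close>: the size of the cut-off does not depend on the
  scale at which a ray is parametrised.
\<close>

definition unit_window :: "real \<Rightarrow> ennreal" where
  "unit_window t = ennreal t * indicator {0<..<1} t"

lemma measurable_unit_window [measurable]: "unit_window \<in> borel_measurable borel"
  unfolding unit_window_def by measurable

lemma measurable_ray_window:
  "(\<lambda>r. ennreal (1 / r) * unit_window (r * a) * indicator {0<..} r) \<in> borel_measurable borel"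
  by measurable

lemma nn_integral_unit_window:
  assumes "0 < a"
  shows "(\<integral>\<^sup>+r. ennreal (1 / r) * unit_window (r * a) * indicator {0<..} r \<partial>lborel) = 1"
proof -
  have "(\<integral>\<^sup>+r. ennreal (1 / r) * unit_window (r * a) * indicator {0<..} r \<partial>lborel) =
      (\<integral>\<^sup>+r. ennreal a * indicator {0<..<1 / a} r \<partial>lborel)"
  proof (rule nn_integral_cong)
    fix r :: real
    show "ennreal (1 / r) * unit_window (r * a) * indicator {0<..} r = ennreal a * indicator {0<..<1 / a} r"
    proof (cases "0 < r")
      case True
      have "ennreal (1 / r) * ennreal (r * a) = ennreal a"
        using True assms by (simp add: ennreal_mult[symmetric])
      moreover have "(0 < r * a \<and> r * a < 1) = (r < 1 / a)"
        using True assms by (simp add: field_simps)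
      ultimately show ?thesis using True by (simp add: unit_window_def indicator_def)
    qed (simp add: indicator_def)
  qed
  also have "\<dots> = ennreal a * emeasure lborel {0<..<1 / a}"
    by (rule nn_integral_cmult_indicator) simp
  also have "\<dots> = 1" using assms by (simp add: ennreal_mult[symmetric])
  finally show ?thesis .
qed

lemma sets_lebesgue_prod: "sets (lebesgue_prod I) = sets (\<Pi>\<^sub>M i\<in>I. borel :: real measure)"
  by (intro sets_PiM_cong) simp_all

lemma measurable_simplex_borelI:
  "f \<in> lebesgue_prod {1..d} \<rightarrow>\<^sub>M N \<Longrightarrow> f \<in> simplex_borel d \<rightarrow>\<^sub>M N"
  unfolding simplex_borel_def
  by (intro measurable_restrict_space1) (simp add: measurable_cong_sets[OF sets_lebesgue_prod refl])

text \<open>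
  Integration along rays. For \<open>g\<close> homogeneous of degree \<open>-d\<close>, the substitution
  \<open>x = r z\<close> with \<open>z\<close> on the simplex gives \<open>g x dx = g z dz dr / r\<close>, and the cut-off makes the integral
  over \<open>r\<close> equal to 1. The gauge \<open>N\<close> in the cut-off is free. The Brun algorithm does not preserve
  the norm, and this freedom lets the norm of the image serve as gauge before a step
  and the norm itself after it.

  The substitution is made in two steps, first the shear \<open>x d \<mapsto> r = \<Sum>x\<close>, then for fixed \<open>r\<close> the
  dilation by \<open>r\<close> of the other \<open>d - 1\<close> coordinates.
\<close>

lemma nn_integral_simplex_eq_cone:
  fixes N :: "(nat \<Rightarrow> real) \<Rightarrow> real"
  assumes d: "1 \<le> d"
    and g [measurable]: "g \<in> borel_measurable (lebesgue_prod {1..d})"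
    and N [measurable]: "N \<in> borel_measurable (lebesgue_prod {1..d})"
    and g_zero: "\<And>x. x \<notin> pos_cone d \<Longrightarrow> g x = 0"
    and g_hom: "\<And>r x. 0 < r \<Longrightarrow> x \<in> std_simplex d \<Longrightarrow> g (\<lambda>i\<in>{1..d}. r * x i) = ennreal ((1 / r) ^ d) * g x"
    and N_hom: "\<And>r x. 0 < r \<Longrightarrow> x \<in> std_simplex d \<Longrightarrow> N (\<lambda>i\<in>{1..d}. r * x i) = r * N x"
    and N_pos: "\<And>x. x \<in> std_simplex d \<Longrightarrow> 0 < N x"
  shows "(\<integral>\<^sup>+x. g x * unit_window (N x) \<partial>lebesgue_prod {1..d}) = (\<integral>\<^sup>+x. g x \<partial>simplex_lebesgue d)"
proof -
  define I where "I = {1..<d}"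
  have I: "finite I" "d \<notin> I" "insert d I = {1..d}" "card I = d - 1" using d by (auto simp: I_def)
  define G where "G x = g x * unit_window (N x)" for x
  have G [measurable]: "G \<in> borel_measurable (lebesgue_prod {1..d})"
    unfolding G_def using g measurable_compose[OF N measurable_unit_window]
    by (rule borel_measurable_times_ennreal)
  have G_zero: "G x = 0" if "x \<notin> pos_cone d" for x using g_zero[OF that] by (simp add: G_def)
  have sum_I: "(\<lambda>x. \<Sum>j\<in>I. x j) \<in> borel_measurable (lebesgue_prod K)" if "I \<subseteq> K" for K
    using that by (intro borel_measurable_sum measurable_coord) auto
  have lift_meas [measurable]: "(\<lambda>x. simplex_lift d x i) \<in> borel_measurable (lebesgue_prod {1..d})" if "i \<in> {1..d}" for i
    using that I(3) sum_I[of "{1..d}"] by (cases "i = d") (auto simp: simplex_lift_def I_def)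
  \<comment> \<open>The integrand in the coordinates \<open>(y, r)\<close>, with \<open>r\<close> stored as the \<open>d\<close>-th coordinate; it includes
    the Jacobian \<open>r ^ (d - 1)\<close>. Coding it as a function on the product makes both orders of
    integration available.\<close>
  define k where "k x = indicator {0<..} (x d) * ennreal (x d ^ (d - 1)) *
      G (\<lambda>i\<in>{1..d}. x d * simplex_lift d x i)" for x
  have dU: "d \<in> {1..d}" using d by simp
  have coord_d [measurable]: "(\<lambda>x. x d) \<in> borel_measurable (lebesgue_prod {1..d})"
    using dU by (rule measurable_coord)
  have "(\<lambda>x. \<lambda>i\<in>{1..d}. x d * simplex_lift d x i) \<in> lebesgue_prod {1..d} \<rightarrow>\<^sub>M lebesgue_prod {1..d}"
  proof (rule measurable_into_lebesgue_prod)
    fix i assume i: "i \<in> {1..d}"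
    have "(\<lambda>x. x d * simplex_lift d x i) \<in> borel_measurable (lebesgue_prod {1..d})"
      using coord_d lift_meas[OF i] by (rule borel_measurable_times)
    then show "(\<lambda>x. (\<lambda>i\<in>{1..d}. x d * simplex_lift d x i) i) \<in> borel_measurable (lebesgue_prod {1..d})"
      using i by simp
  qed simp
  note [measurable] = measurable_compose[OF this G]
  have k [measurable]: "k \<in> borel_measurable (lebesgue_prod {1..d})"
    unfolding k_def by measurable
  have lift_upd: "simplex_lift d (y(d := t)) = simplex_lift d y" for y t
    by (auto simp: simplex_lift_def fun_eq_iff intro!: sum.cong)
  have slice: "(\<integral>\<^sup>+y. G (y(d := r - (\<Sum>j\<in>I. y j))) \<partial>lebesgue_prod I) = (\<integral>\<^sup>+y. k (y(d := r)) \<partial>lebesgue_prod I)"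
    for r
  proof (cases "0 < r")
    case False
    have "y(d := r - (\<Sum>j\<in>I. y j)) \<notin> pos_cone d" for y
    proof
      assume pos: "y(d := r - (\<Sum>j\<in>I. y j)) \<in> pos_cone d"
      have "0 < (\<Sum>i\<in>{1..d}. (y(d := r - (\<Sum>j\<in>I. y j))) i)"
        using pos d by (intro sum_pos) (auto simp: pos_cone_def)
      also have "\<dots> = (\<Sum>i\<in>insert d I. (y(d := r - (\<Sum>j\<in>I. y j))) i)" by (simp only: I(3))
      also have "\<dots> = r" using I(1,2) by (auto intro!: sum.cong)
      finally show False using False by simp
    qed
    then show ?thesis using False by (simp add: G_zero k_def indicator_def)
  next
    case True
    have *: "(\<lambda>y. G (y(d := r - (\<Sum>j\<in>I. y j)))) \<in> borel_measurable (lebesgue_prod I)"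
      using measurable_compose[OF measurable_insert_coord G[folded I(3)]] sum_I[of I] by simp
    have "(\<integral>\<^sup>+y. G (y(d := r - (\<Sum>j\<in>I. y j))) \<partial>lebesgue_prod I) = ennreal (r ^ (d - 1)) *
        (\<integral>\<^sup>+y. G ((\<lambda>i\<in>I. r * y i)(d := r - (\<Sum>j\<in>I. (\<lambda>i\<in>I. r * y i) j))) \<partial>lebesgue_prod I)"
      using nn_integral_dilate[OF I(1) * True] I(4) by simp
    also have "\<dots> = ennreal (r ^ (d - 1)) *
        (\<integral>\<^sup>+y. G (\<lambda>i\<in>{1..d}. r * simplex_lift d y i) \<partial>lebesgue_prod I)"
    proof -
      have "(\<lambda>i\<in>I. r * y i)(d := r - (\<Sum>j\<in>I. (\<lambda>i\<in>I. r * y i) j)) = (\<lambda>i\<in>{1..d}. r * simplex_lift d y i)" for y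
        using d by (auto simp: simplex_lift_def fun_eq_iff I_def sum_distrib_left right_diff_distrib)
      then show ?thesis by simp
    qed
    also have "\<dots> = (\<integral>\<^sup>+y. ennreal (r ^ (d - 1)) * G (\<lambda>i\<in>{1..d}. r * simplex_lift d y i) \<partial>lebesgue_prod I)"
    proof (rule nn_integral_cmult[symmetric])
      have "(\<lambda>y. \<lambda>i\<in>{1..d}. r * simplex_lift d y i) \<in> lebesgue_prod I \<rightarrow>\<^sub>M lebesgue_prod {1..d}"
      proof (rule measurable_into_lebesgue_prod)
        fix i assume i: "i \<in> {1..d}"
        have "(\<lambda>y. simplex_lift d y i) \<in> borel_measurable (lebesgue_prod I)"
          using i I(3) sum_I[of I] measurable_coord[of i I]
          by (cases "i = d") (auto simp: simplex_lift_def I_def)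
        then have "(\<lambda>y. r * simplex_lift d y i) \<in> borel_measurable (lebesgue_prod I)"
          by (intro borel_measurable_times borel_measurable_const)
        then show "(\<lambda>y. (\<lambda>i\<in>{1..d}. r * simplex_lift d y i) i) \<in> borel_measurable (lebesgue_prod I)"
          using i by simp
      qed simp
      from measurable_compose[OF this G]
      show "(\<lambda>y. G (\<lambda>i\<in>{1..d}. r * simplex_lift d y i)) \<in> borel_measurable (lebesgue_prod I)" .
    qed
    also have "\<dots> = (\<integral>\<^sup>+y. k (y(d := r)) \<partial>lebesgue_prod I)"
      using True by (simp add: k_def lift_upd)
    finally show ?thesis .
  qed
  have ray: "(\<integral>\<^sup>+r. k (y(d := r)) \<partial>lborel) = g (simplex_lift d y) * indicator (std_simplex d) (simplex_lift d y)"
    for y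
  proof (cases "simplex_lift d y \<in> std_simplex d")
    case False
    have "k (y(d := r)) = 0" for r
    proof (cases "0 < r")
      case True
      have "(\<lambda>i\<in>{1..d}. r * simplex_lift d y i) \<notin> pos_cone d"
        using False True sum_simplex_lift[OF d, of y]
        by (auto simp: std_simplex_def pos_cone_def zero_less_mult_iff) (auto simp: simplex_lift_def)
      then show ?thesis using G_zero by (simp add: k_def lift_upd)
    qed (simp add: k_def)
    then show ?thesis using False by simp
  next
    case z: True
    have "k (y(d := r)) = g (simplex_lift d y) *
        (ennreal (1 / r) * unit_window (r * N (simplex_lift d y)) * indicator {0<..} r)" for r
    proof (cases "0 < r")
      case True
      have "r ^ (d - 1) * (1 / r) ^ d = 1 / r"
        using True d by (cases d) (simp_all add: field_simps)
      then have "ennreal (r ^ (d - 1)) * ennreal ((1 / r) ^ d) = ennreal (1 / r)"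
        using True by (simp add: ennreal_mult[symmetric])
      then have "ennreal (r ^ (d - 1)) * (ennreal ((1 / r) ^ d) * a) = ennreal (1 / r) * a" for a
        by (simp add: mult.assoc[symmetric])
      moreover have "k (y(d := r)) = ennreal (r ^ (d - 1)) *
          (ennreal ((1 / r) ^ d) * (g (simplex_lift d y) * unit_window (r * N (simplex_lift d y))))"
        using True g_hom[OF True z] N_hom[OF True z] by (simp add: k_def G_def lift_upd mult.assoc)
      ultimately have "k (y(d := r)) = ennreal (1 / r) *
          (g (simplex_lift d y) * unit_window (r * N (simplex_lift d y)))" by (simp only:)
      then show ?thesis using True by (simp add: mult_ac)
    qed (simp add: k_def)
    then have "(\<integral>\<^sup>+r. k (y(d := r)) \<partial>lborel) = (\<integral>\<^sup>+r. g (simplex_lift d y) *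
        (ennreal (1 / r) * unit_window (r * N (simplex_lift d y)) * indicator {0<..} r) \<partial>lborel)"
      by (rule nn_integral_cong)
    also have "\<dots> = g (simplex_lift d y) *
        (\<integral>\<^sup>+r. ennreal (1 / r) * unit_window (r * N (simplex_lift d y)) * indicator {0<..} r \<partial>lborel)"
      using measurable_ray_window by (intro nn_integral_cmult) simp
    finally show ?thesis using z N_pos[OF z] by (simp add: nn_integral_unit_window)
  qed
  have sum_U: "(\<lambda>x. - (\<Sum>j\<in>I. x j)) \<in> borel_measurable (lebesgue_prod {1..d})"
    using sum_I[of "{1..d}"] I(3) by (intro borel_measurable_uminus) auto
  have "(\<lambda>x. - (\<Sum>j\<in>I. x j) + 1 * x d) \<in> borel_measurable (lebesgue_prod {1..d})"
    using sum_U coord_d by simp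
  from measurable_compose[OF measurable_coord_update[OF dU this] G]
  have upd_meas: "(\<lambda>x. G (x(d := - (\<Sum>j\<in>I. x j) + 1 * x d))) \<in> borel_measurable (lebesgue_prod {1..d})" .
  have upd_sum: "(\<Sum>j\<in>I. (x(d := t)) j) = (\<Sum>j\<in>I. x j)" for x :: "nat \<Rightarrow> real" and t
    using I by (auto intro!: sum.cong)
  note upd_sum' = upd_sum[unfolded fun_upd_apply]
  have "(\<integral>\<^sup>+x. G x \<partial>lebesgue_prod {1..d}) =
      ennreal \<bar>1\<bar> * (\<integral>\<^sup>+x. G (x(d := - (\<Sum>j\<in>I. x j) + 1 * x d)) \<partial>lebesgue_prod {1..d})"
    by (rule nn_integral_affine_coord[OF _ dU _ G sum_U]) (simp_all only: upd_sum finite_atLeastAtMost one_neq_zero not_False_eq_True)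
  also have "\<dots> = (\<integral>\<^sup>+x. G (x(d := - (\<Sum>j\<in>I. x j) + 1 * x d)) \<partial>lebesgue_prod {1..d})" by simp
  also have "\<dots> = (\<integral>\<^sup>+r. (\<integral>\<^sup>+y. G (y(d := r - (\<Sum>j\<in>I. y j))) \<partial>lebesgue_prod I) \<partial>lborel)"
    using lebesgue_prod.product_nn_integral_insert_rev[OF I(1,2), of "\<lambda>x. G (x(d := - (\<Sum>j\<in>I. x j) + 1 * x d))"] upd_meas
    by (simp add: I(3) upd_sum')
  also have "\<dots> = (\<integral>\<^sup>+r. (\<integral>\<^sup>+y. k (y(d := r)) \<partial>lebesgue_prod I) \<partial>lborel)"
    by (simp only: slice)
  also have "\<dots> = (\<integral>\<^sup>+x. k x \<partial>lebesgue_prod {1..d})"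
    using lebesgue_prod.product_nn_integral_insert_rev[OF I(1,2), of k] k by (simp add: I(3))
  also have "\<dots> = (\<integral>\<^sup>+y. (\<integral>\<^sup>+r. k (y(d := r)) \<partial>lborel) \<partial>lebesgue_prod I)"
    using lebesgue_prod.product_nn_integral_insert[OF I(1,2), of k] k by (simp add: I(3))
  also have "\<dots> = (\<integral>\<^sup>+x. g x \<partial>simplex_lebesgue d)"
    using nn_integral_simplex_lebesgue[OF measurable_simplex_borelI[OF g]] by (simp only: ray I_def)
  finally show ?thesis by (simp add: G_def)
qed

text \<open>
  For fixed other coordinates, each equation \<open>x a = x b\<close> has a single solution \<open>x a\<close>.
\<close>

lemma AE_distinct_coords:
  assumes "finite I"
  shows "AE x in lebesgue_prod I. inj_on x I"
proof -
  have "AE x in lebesgue_prod I. x a \<noteq> x b" if ab: "a \<in> I" "b \<in> I" "a \<noteq> b" for a b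
  proof -
    define J where "J = I - {a}"
    have J: "finite J" "a \<notin> J" "insert a J = I" using ab assms by (auto simp: J_def)
    have "(\<lambda>x. x a - x b) \<in> borel_measurable (lebesgue_prod I)"
      using ab by (intro borel_measurable_diff measurable_coord)
    from measurable_compose[OF this borel_measurable_indicator[of "{0}" borel]]
    have meas: "(\<lambda>x. indicator {0} (x a - x b) :: ennreal) \<in> borel_measurable (lebesgue_prod I)"
      by simp
    have "(\<integral>\<^sup>+x. indicator {0} (x a - x b) \<partial>lebesgue_prod I) =
        (\<integral>\<^sup>+x. (\<integral>\<^sup>+t. indicator {0} (t - x b) \<partial>lborel) \<partial>lebesgue_prod J)"
      using lebesgue_prod.product_nn_integral_insert[OF J(1,2), of "\<lambda>x. indicator {0} (x a - x b)"] J(3) ab(3) meas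
      by simp
    also have "\<dots> = (\<integral>\<^sup>+x. (\<integral>\<^sup>+t. indicator {x b} t \<partial>lborel) \<partial>lebesgue_prod J)"
      by (intro nn_integral_cong) (simp add: indicator_def)
    also have "\<dots> = 0" by simp
    finally have "AE x in lebesgue_prod I. indicator {0} (x a - x b) = (0 :: ennreal)"
      using meas by (subst (asm) nn_integral_0_iff_AE)
    then show ?thesis by eventually_elim (auto simp: indicator_def split: if_splits)
  qed
  then have "AE x in lebesgue_prod I. \<forall>a\<in>I. \<forall>b\<in>I. a \<noteq> b \<longrightarrow> x a \<noteq> x b"
    using assms by (intro AE_finite_allI) auto
  then show ?thesis by eventually_elim (auto simp: inj_on_def)
qed

section \<open>The density on the cone and its transfer equation\<close>

text \<open>
  The Brun algorithm and its density depend on the ordering of the coordinates only through the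
  positions \<open>i\<close> of the largest and \<open>j\<close> of the second largest coordinate, so the cones
  \<open>top_two d i j\<close> replace the smaller cones of the individual permutations.
\<close>

definition top_two :: "nat \<Rightarrow> nat \<Rightarrow> nat \<Rightarrow> (nat \<Rightarrow> real) set" where
  "top_two d i j = {x \<in> pos_cone d. inj_on x {1..d} \<and> x j < x i \<and> (\<forall>k\<in>{1..d} - {i, j}. x k < x j)}"

text \<open>
  The density formula, extended from the simplex to a function on the cone that is homogeneous of
  degree \<open>-d\<close>: the number 1 in its denominators stands for the sum of all coordinates.
\<close>

definition branch_density :: "nat \<Rightarrow> nat \<Rightarrow> nat \<Rightarrow> (nat \<Rightarrow> real) \<Rightarrow> real" where
  "branch_density d i j x = chain_sum (recip_sum x) (d - 2) {i} ({1..d} - {j}) / (fact (d - 1) * x j)"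

definition cone_density :: "nat \<Rightarrow> (nat \<Rightarrow> real) \<Rightarrow> real" where
  "cone_density d x = (\<Sum>i\<in>{1..d}. \<Sum>j\<in>{1..d} - {i}. indicator (top_two d i j) x * branch_density d i j x)"

lemma top_two_dominates:
  assumes "x \<in> top_two d i j" "k \<in> {1..d}" "k \<noteq> i"
  shows "x k < x i" "k \<noteq> j \<Longrightarrow> x k < x j"
proof -
  show j: "k \<noteq> j \<Longrightarrow> x k < x j" using assms by (simp add: top_two_def)
  show "x k < x i" using j assms(1) by (cases "k = j") (auto simp: top_two_def)
qed

lemma top_two_unique:
  assumes "x \<in> top_two d i j" "x \<in> top_two d i' j'" "{i, j, i', j'} \<subseteq> {1..d}" "i \<noteq> j" "i' \<noteq> j'"
  shows "i' = i \<and> j' = j"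
proof -
  have i: "i' = i"
    using top_two_dominates(1)[OF assms(1), of i'] top_two_dominates(1)[OF assms(2), of i] assms(3) by force
  moreover have "j' = j"
    using top_two_dominates(2)[OF assms(1), of j'] top_two_dominates(2)[OF assms(2), of j] assms(3-5) i by force
  ultimately show ?thesis ..
qed

lemma cone_density_top_two:
  assumes x: "x \<in> top_two d i j" and ij: "i \<in> {1..d}" "j \<in> {1..d}" "i \<noteq> j"
  shows "cone_density d x = branch_density d i j x"
proof -
  have ind: "indicator (top_two d a b) x * branch_density d a b x =
      (if b = j then if a = i then branch_density d i j x else 0 else 0)"
    if "a \<in> {1..d}" "b \<in> {1..d} - {a}" for a b
  proof (cases "x \<in> top_two d a b")
    case True
    then have "a = i \<and> b = j" using top_two_unique[OF x True] that ij by blast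
    then show ?thesis using x by simp
  next
    case False
    then have "\<not> (a = i \<and> b = j)" using x by blast
    then show ?thesis using False by simp
  qed
  have "cone_density d x = (\<Sum>a\<in>{1..d}. \<Sum>b\<in>{1..d} - {a}.
      if b = j then if a = i then branch_density d i j x else 0 else 0)"
    unfolding cone_density_def using ind by (intro sum.cong refl) blast
  also have "\<dots> = (\<Sum>a\<in>{1..d}. if a = i then branch_density d i j x else 0)"
    using ij by (intro sum.cong refl) simp
  also have "\<dots> = branch_density d i j x" using ij by simp
  finally show ?thesis .
qed

lemma cone_density_eq_0:
  "\<not> (x \<in> pos_cone d \<and> inj_on x {1..d}) \<Longrightarrow> cone_density d x = 0"
  by (auto simp: cone_density_def top_two_def)

text \<open>
  The permutation sends \<open>k\<close> to the position of the \<open>k\<close>-th entry of the increasing list of coordinates.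
\<close>

lemma perm_cone_exists:
  assumes x: "x \<in> pos_cone d" and inj: "inj_on x {1..d}"
  obtains \<pi> where "\<pi> permutes {1..d}" "x \<in> perm_cone d \<pi>"
proof
  define l where "l = sorted_list_of_set (x ` {1..d})"
  have l: "distinct l" "set l = x ` {1..d}" "length l = d" "sorted_wrt (<) l"
    using card_image[OF inj] by (simp_all add: l_def)
  define \<pi> where "\<pi> k = (if k \<in> {1..d} then inv_into {1..d} x (l ! (k - 1)) else k)" for k
  have "bij_betw (\<lambda>k. k - 1) {1..d} {..<d}"
    by (rule bij_betw_byWitness[where f' = Suc]) auto
  moreover have "bij_betw ((!) l) {..<d} (x ` {1..d})"
    using l by (intro bij_betw_nth) auto
  moreover have "bij_betw (inv_into {1..d} x) (x ` {1..d}) {1..d}"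
    using inj by (intro bij_betw_inv_into) (simp add: bij_betw_def)
  ultimately have "bij_betw (inv_into {1..d} x \<circ> ((!) l \<circ> (\<lambda>k. k - 1))) {1..d} {1..d}"
    by (intro bij_betw_trans)
  then have "bij_betw \<pi> {1..d} {1..d}"
    by (rule bij_betw_cong[THEN iffD1, rotated]) (simp add: \<pi>_def)
  then show "\<pi> permutes {1..d}"
    by (rule bij_imp_permutes) (auto simp: \<pi>_def)
  have x\<pi>: "x (\<pi> k) = l ! (k - 1)" if "k \<in> {1..d}" for k
  proof -
    have "k - 1 < length l" using that l(3) by auto
    then have "l ! (k - 1) \<in> x ` {1..d}" using nth_mem l(2) by metis
    then show ?thesis using that by (simp add: \<pi>_def f_inv_into_f del: One_nat_def)
  qed
  have "x (\<pi> k) < x (\<pi> (Suc k))" if "k \<in> {1..<d}" for k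
    using that x\<pi>[of k] x\<pi>[of "Suc k"] sorted_wrt_nth_less[OF l(4), of "k - 1" k] l(3) by simp
  then show "x \<in> perm_cone d \<pi>" using x by (simp add: perm_cone_def)
qed

lemma perm_cone_top_two:
  assumes d: "2 \<le> d" and \<pi>: "\<pi> permutes {1..d}" and x: "x \<in> perm_cone d \<pi>"
  shows "x \<in> top_two d (\<pi> d) (\<pi> (d - 1))"
proof -
  have step: "x (\<pi> k) < x (\<pi> (Suc k))" if "1 \<le> k" "k < d" for k
    using x that by (simp add: perm_cone_def)
  have less: "x (\<pi> a) < x (\<pi> b)" if "1 \<le> a" "a < b" "b \<le> d" for a b
    using that(2,3)
  proof (induction b)
    case (Suc b)
    then show ?case using step[of b] that(1) by (cases "a = b") force+
  qed simp
  have surj: "\<exists>a\<in>{1..d}. k = \<pi> a" if "k \<in> {1..d}" for k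
    using that permutes_image[OF \<pi>] by blast
  have "inj_on x {1..d}"
  proof (rule inj_onI)
    fix u v assume uv: "u \<in> {1..d}" "v \<in> {1..d}" "x u = x v"
    then obtain a b where ab: "a \<in> {1..d}" "b \<in> {1..d}" "u = \<pi> a" "v = \<pi> b" using surj by meson
    then show "u = v" using less[of a b] less[of b a] uv(3) by (cases a b rule: linorder_cases) auto
  qed
  moreover have "x k < x (\<pi> (d - 1))" if k: "k \<in> {1..d} - {\<pi> d, \<pi> (d - 1)}" for k
  proof -
    obtain a where "a \<in> {1..d}" "k = \<pi> a" using surj[of k] k by blast
    moreover from this k have "a \<noteq> d" "a \<noteq> d - 1" by auto
    ultimately show ?thesis using less[of a "d - 1"] by auto
  qed
  moreover have "x (\<pi> (d - 1)) < x (\<pi> d)" using d by (intro less) auto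
  moreover have "x \<in> pos_cone d" using x by (simp add: perm_cone_def)
  ultimately show ?thesis unfolding top_two_def by blast
qed

lemma top_two_exists:
  assumes "2 \<le> d" "x \<in> pos_cone d" "inj_on x {1..d}"
  obtains i j where "i \<in> {1..d}" "j \<in> {1..d}" "i \<noteq> j" "x \<in> top_two d i j"
proof -
  obtain \<pi> where \<pi>: "\<pi> permutes {1..d}" "x \<in> perm_cone d \<pi>"
    using perm_cone_exists[OF assms(2,3)] .
  have "\<pi> d \<in> {1..d}" "\<pi> (d - 1) \<in> {1..d}"
    using assms(1) by (simp_all only: permutes_in_image[OF \<pi>(1)]) auto
  moreover have "\<pi> d \<noteq> \<pi> (d - 1)"
    using assms(1) by (simp add: inj_eq[OF permutes_inj[OF \<pi>(1)]])
  ultimately show ?thesis using perm_cone_top_two[OF assms(1) \<pi>] that by blast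
qed

lemma regular_simplex_iff:
  assumes "2 \<le> d"
  shows "x \<in> regular_simplex d \<longleftrightarrow> x \<in> std_simplex d \<and> inj_on x {1..d}"
proof
  assume "x \<in> regular_simplex d"
  then obtain \<pi> where "\<pi> permutes {1..d}" "x \<in> perm_cone d \<pi>" "x \<in> std_simplex d"
    by (auto simp: regular_simplex_def)
  then show "x \<in> std_simplex d \<and> inj_on x {1..d}"
    using perm_cone_top_two[OF assms] by (auto simp: top_two_def)
next
  assume x: "x \<in> std_simplex d \<and> inj_on x {1..d}"
  then obtain \<pi> where "\<pi> permutes {1..d}" "x \<in> perm_cone d \<pi>"
    using perm_cone_exists[of x d] by (auto simp: std_simplex_def)
  then show "x \<in> regular_simplex d" using x by (auto simp: regular_simplex_def)
qed

lemma brun_chains_eq_set_chains: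
  assumes "2 \<le> d"
  shows "brun_chains d \<pi> = set_chains {1..d} (d - 2) {\<pi> (d - 1)} ({1..d} - {\<pi> d})"
proof -
  define n where "n = d - 2"
  have n: "d = Suc (Suc n)" using assms by (simp add: n_def)
  have sets: "{1..<d - 1} = {1..n}" "{1..<Suc n} = {1..n}" "d - 1 = Suc n" using n by auto
  have "Suc (card B) = card {\<pi> (d - 1)} + k \<longleftrightarrow> card B = k" for B :: "nat set" and k by simp
  then show ?thesis
    unfolding brun_chains_def set_chains_def n_def[symmetric] sets by (simp only: )
qed

lemma brun_density_eq_cone_density:
  assumes d: "2 \<le> d" and x: "x \<in> std_simplex d"
  shows "brun_density d x = cone_density d x"
proof (cases "inj_on x {1..d}")
  case False
  then show ?thesis
    using regular_simplex_iff[OF d] cone_density_eq_0 by (simp add: brun_density_def)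
next
  case True
  then obtain \<pi> where \<pi>: "\<pi> permutes {1..d}" "x \<in> perm_cone d \<pi>"
    using perm_cone_exists[of x d] x by (auto simp: std_simplex_def)
  let ?U = "{1..d}" and ?i = "\<pi> d" and ?j = "\<pi> (d - 1)"
  have ij: "?i \<in> ?U" "?j \<in> ?U" "?i \<noteq> ?j"
    using d permutes_in_image[OF \<pi>(1)] by (auto simp: inj_eq[OF permutes_inj[OF \<pi>(1)]])
  have weight: "1 / (1 - (\<Sum>i\<in>A. x i)) = recip_sum x (?U - A)" if "A \<subseteq> ?U" for A
    using that x by (simp add: recip_sum_def std_simplex_def sum_diff)
  have dd: "Suc (d - 2) = d - 1" using d by simp
  have "(\<Sum>A\<in>brun_chains d \<pi>. \<Prod>k\<in>{1..d - 1}. 1 / (1 - (\<Sum>i\<in>A k. x i))) =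
      (\<Sum>A\<in>set_chains ?U (d - 2) {?j} (?U - {?i}). \<Prod>k\<in>{1..Suc (d - 2)}. recip_sum x (?U - A k))"
    unfolding brun_chains_eq_set_chains[OF d] dd
  proof (intro sum.cong prod.cong refl weight)
    fix A k assume "A \<in> set_chains ?U (d - 2) {?j} (?U - {?i})" "k \<in> {1..d - 1}"
    then show "A k \<subseteq> ?U" using dd by (auto simp: set_chains_def PiE_iff)
  qed
  also have "\<dots> = chain_sum (recip_sum x) (d - 2) (?U - (?U - {?i})) (?U - {?j})"
    using ij d by (intro sum_set_chains) auto
  also have "?U - (?U - {?i}) = {?i}" using ij by auto
  finally have "brun_density d x = branch_density d ?i ?j x"
    using regular_simplex_iff[OF d] x True order_perm_eq[OF \<pi>]
    by (simp add: brun_density_def branch_density_def)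
  also have "\<dots> = cone_density d x"
    using cone_density_top_two[OF perm_cone_top_two[OF d \<pi>] ij] by simp
  finally show ?thesis .
qed

lemma branch_density_nonneg:
  assumes "x \<in> pos_cone d" "i \<in> {1..d}" "j \<in> {1..d}"
  shows "0 \<le> branch_density d i j x"
proof -
  have weight: "0 \<le> recip_sum x S" if "S \<subseteq> {1..d}" for S
  proof -
    have "0 < x s" if "s \<in> S" for s
      using assms(1) subsetD[OF \<open>S \<subseteq> {1..d}\<close> that] by (simp add: pos_cone_def)
    then have "0 \<le> x s" if "s \<in> S" for s using that by (simp add: less_imp_le)
    then show ?thesis by (simp add: recip_sum_def sum_nonneg)
  qed
  have "0 \<le> chain_sum (recip_sum x) n R S" if "S \<subseteq> {1..d}" for n R S
    using that
  proof (induction n arbitrary: S)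
    case (Suc n)
    have "0 \<le> (\<Sum>a\<in>S - R. chain_sum (recip_sum x) n R (S - {a}))"
      using Suc.prems by (intro sum_nonneg Suc.IH) blast
    then show ?case using weight[OF Suc.prems] by simp
  qed (simp add: weight)
  then have "0 \<le> chain_sum (recip_sum x) (d - 2) {i} ({1..d} - {j})" by blast
  moreover have "0 < x j" using assms by (simp add: pos_cone_def)
  ultimately show ?thesis by (simp add: branch_density_def)
qed

lemma branch_term_nonneg:
  assumes "i \<in> {1..d}" "j \<in> {1..d}"
  shows "0 \<le> indicator (top_two d i j) x * branch_density d i j x"
proof (cases "x \<in> top_two d i j")
  case True
  then have "x \<in> pos_cone d" by (simp add: top_two_def)
  then show ?thesis using True assms branch_density_nonneg[of x d i j] by simp
qed simp

lemma cone_density_nonneg: "0 \<le> cone_density d x"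
  unfolding cone_density_def by (intro sum_nonneg branch_term_nonneg) auto

text \<open>
  The map that adds coordinate \<open>j\<close> to coordinate \<open>i\<close> is an inverse branch of the algorithm at \<open>y\<close>
  exactly if its image has \<open>i\<close> as largest and \<open>j\<close> as second largest coordinate. The enlarged
  coordinate \<open>i\<close> exceeds the coordinate \<open>j\<close> automatically, so the condition is that \<open>j\<close> is the
  position of the maximum of \<open>y\<close> over the coordinates other than \<open>i\<close>. Therefore a \<open>y\<close> with
  distinct coordinates has exactly \<open>d\<close> preimages, one for each \<open>i\<close>.
\<close>

lemma brun_branch_top_two_iff:
  assumes y: "y \<in> top_two d m p" and mp: "m \<in> {1..d}" "p \<in> {1..d}" "m \<noteq> p"
    and ij: "i \<in> {1..d}" "j \<in> {1..d}" "i \<noteq> j"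
  shows "y(i := y j + y i) \<in> top_two d i j \<longleftrightarrow> j = (if i = m then p else m)"
proof -
  define q where "q = (if i = m then p else m)"
  have q: "q \<in> {1..d}" "q \<noteq> i" using mp by (auto simp: q_def)
  have pos: "0 < y k" if "k \<in> {1..d}" for k using y that by (simp add: top_two_def pos_cone_def)
  have ext: "y \<in> extensional {1..d}" and inj: "inj_on y {1..d}"
    using y by (auto simp: top_two_def pos_cone_def PiE_def)
  have max: "y k < y q" if "k \<in> {1..d}" "k \<noteq> i" "k \<noteq> q" for k
    using top_two_dominates[OF y, of k] that by (auto simp: q_def split: if_splits)
  have "y(i := y j + y i) \<in> top_two d i j \<longleftrightarrow> j = q"
  proof
    assume "y(i := y j + y i) \<in> top_two d i j"
    then have "\<forall>k\<in>{1..d} - {i, j}. y k < y j" using ij(3) by (simp add: top_two_def)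
    then have "y q < y j" if "j \<noteq> q" using that q by blast
    then show "j = q" using max[of j] ij by (metis less_asym)
  next
    assume j: "j = q"
    have le: "y k < y j + y i" if "k \<in> {1..d}" "k \<noteq> i" for k
      using that max[of k] pos[OF ij(1)] j by (cases "k = q") auto
    have "inj_on (y(i := y j + y i)) {1..d}"
    proof (rule inj_onI)
      fix a b assume ab: "a \<in> {1..d}" "b \<in> {1..d}" "(y(i := y j + y i)) a = (y(i := y j + y i)) b"
      have "a \<noteq> i \<or> b = i"
        using le[of b] ab by force
      moreover have "b \<noteq> i \<or> a = i"
        using le[of a] ab by force
      ultimately show "a = b" using inj_onD[OF inj _ ab(1,2)] ab(3) by auto
    qed
    moreover have "y(i := y j + y i) \<in> pos_cone d"
    proof -
      have "0 < (y(i := y j + y i)) k" if "k \<in> {1..d}" for k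
        using pos[OF that] pos[OF ij(1)] pos[OF ij(2)] by simp
      moreover have "y(i := y j + y i) \<in> {1..d} \<rightarrow>\<^sub>E UNIV"
        using ext ij(1) by (auto simp: PiE_def extensional_def)
      ultimately show ?thesis unfolding pos_cone_def by blast
    qed
    moreover have "(y(i := y j + y i)) j < (y(i := y j + y i)) i"
      using ij pos[OF ij(1)] by simp
    moreover have "(y(i := y j + y i)) k < (y(i := y j + y i)) j" if "k \<in> {1..d} - {i, j}" for k
      using max[of k] that ij(3) j by simp
    ultimately show "y(i := y j + y i) \<in> top_two d i j" unfolding top_two_def by blast
  qed
  then show ?thesis by (simp only: q_def)
qed

lemma chain_sum_branch:
  fixes d :: nat
  assumes "i \<in> {1..d}" "q \<in> {1..d}" "i \<noteq> q"
  shows "chain_sum (recip_sum (y(i := y q + y i))) n {i} ({1..d} - {q}) =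
    chain_sum (recip_sum y) n {q, i} {1..d}"
proof -
  have "chain_sum (recip_sum (y(i := y q + y i))) n {i} ({1..d} - {q}) =
      chain_sum (recip_sum y) n (insert q {i}) (insert q ({1..d} - {q}))"
  proof (rule chain_sum_adjoin)
    fix B assume B: "{i} \<subseteq> B" "B \<subseteq> {1..d} - {q}"
    then have fin: "finite B" "i \<in> B" "q \<notin> B" by (auto intro: finite_subset)
    have "(\<Sum>b\<in>B. (y(i := y q + y i)) b) = y q + y i + (\<Sum>b\<in>B - {i}. y b)"
      using fin by (subst sum.remove[of B i]) (auto intro!: sum.cong)
    also have "\<dots> = (\<Sum>b\<in>insert q B. y b)"
      using fin by (simp add: sum.remove[of B i])
    finally show "recip_sum (y(i := y q + y i)) B = recip_sum y (insert q B)"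
      by (simp add: recip_sum_def)
  qed (use assms in auto)
  also have "insert q ({1..d} - {q}) = {1..d}" using assms by auto
  finally show ?thesis .
qed

text \<open>
  The transfer equation: the density at \<open>y\<close> is the sum of the densities at the \<open>d\<close> preimages, all
  inverse branches having Jacobian 1. The preimages with \<open>i \<noteq> m\<close> contribute all chains from the full
  set down to \<open>{m}\<close>, classified by the pair \<open>{m, i}\<close> above the bottom (\<open>chain_sum_bottom\<close>); the
  preimage with \<open>i = m\<close> contributes the chains down to \<open>{m, p}\<close>. Then \<open>chain_sum_exchange\<close> applies.
\<close>

lemma cone_density_invariant:
  assumes d: "2 \<le> d" and y: "y \<in> pos_cone d" "inj_on y {1..d}"
  shows "(\<Sum>i\<in>{1..d}. \<Sum>j\<in>{1..d} - {i}.
      indicator (top_two d i j) (y(i := y j + y i)) * branch_density d i j (y(i := y j + y i))) = cone_density d y"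
proof -
  let ?U = "{1..d}"
  let ?K = "chain_sum (recip_sum y)"
  obtain m p where mp: "m \<in> ?U" "p \<in> ?U" "m \<noteq> p" and top: "y \<in> top_two d m p"
    using top_two_exists[OF d y] .
  have pos: "0 < y k" if "k \<in> ?U" for k using y that by (simp add: pos_cone_def)
  define q where "q i = (if i = m then p else m)" for i
  have q: "q i \<in> ?U" "i \<noteq> q i" for i using mp by (auto simp: q_def)
  have branch: "branch_density d i (q i) (y(i := y (q i) + y i)) = ?K (d - 2) {q i, i} ?U / (fact (d - 1) * y (q i))"
    if "i \<in> ?U" for i
    using chain_sum_branch[OF that q(1) q(2), of y] q(2)[of i] by (simp add: branch_density_def)
  have "(\<Sum>i\<in>?U. \<Sum>j\<in>?U - {i}.
      indicator (top_two d i j) (y(i := y j + y i)) * branch_density d i j (y(i := y j + y i))) =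
      (\<Sum>i\<in>?U. \<Sum>j\<in>?U - {i}. if j = q i then ?K (d - 2) {q i, i} ?U / (fact (d - 1) * y (q i)) else 0)"
  proof (intro sum.cong refl)
    fix i j assume ij: "i \<in> ?U" "j \<in> ?U - {i}"
    then show "indicator (top_two d i j) (y(i := y j + y i)) * branch_density d i j (y(i := y j + y i)) =
        (if j = q i then ?K (d - 2) {q i, i} ?U / (fact (d - 1) * y (q i)) else 0)"
      using brun_branch_top_two_iff[OF top mp, of i j] branch[of i] by (auto simp: q_def indicator_def)
  qed
  also have "\<dots> = (\<Sum>i\<in>?U. ?K (d - 2) {q i, i} ?U / (fact (d - 1) * y (q i)))"
    using q(1) q(2)[symmetric] by (intro sum.cong refl) simp
  also have "\<dots> = ?K (d - 2) {m, p} ?U / (fact (d - 1) * y p) +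
      (\<Sum>i\<in>?U - {m}. ?K (d - 2) {m, i} ?U / (fact (d - 1) * y m))"
    using mp by (subst sum.remove[of _ m]) (auto simp: q_def insert_commute intro!: sum.cong)
  also have "(\<Sum>i\<in>?U - {m}. ?K (d - 2) {m, i} ?U / (fact (d - 1) * y m)) =
      ?K (Suc (d - 2)) {m} ?U / fact (d - 1)"
  proof -
    have "?K (Suc (d - 2)) {m} ?U = recip_sum y {m} * (\<Sum>i\<in>?U - {m}. ?K (d - 2) {i, m} ?U)"
      using mp d by (intro chain_sum_bottom) auto
    then show ?thesis
      by (simp add: recip_sum_def insert_commute sum_divide_distrib mult.commute del: chain_sum.simps)
  qed
  also have "?K (d - 2) {m, p} ?U / (fact (d - 1) * y p) + ?K (Suc (d - 2)) {m} ?U / fact (d - 1) =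
      (y p * ?K (Suc (d - 2)) {m} ?U + ?K (d - 2) {m, p} ?U) / (fact (d - 1) * y p)"
    using pos[OF mp(2)] by (simp add: field_simps del: chain_sum.simps)
  also have "y p * ?K (Suc (d - 2)) {m} ?U + ?K (d - 2) {m, p} ?U = ?K (d - 2) {m} (?U - {p})"
    using mp d pos by (intro chain_sum_exchange[symmetric]) auto
  also have "?K (d - 2) {m} (?U - {p}) / (fact (d - 1) * y p) = cone_density d y"
    using cone_density_top_two[OF top mp] by (simp add: branch_density_def)
  finally show ?thesis .
qed

section \<open>Invariance on the simplex\<close>

lemma ennreal_double_sum:
  assumes "\<And>i j. i \<in> A \<Longrightarrow> j \<in> B i \<Longrightarrow> 0 \<le> f i j"
  shows "ennreal (\<Sum>i\<in>A. \<Sum>j\<in>B i. f i j) = (\<Sum>i\<in>A. \<Sum>j\<in>B i. ennreal (f i j))"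
  using assms by (simp add: sum_ennreal sum_nonneg)

lemma nn_integral_double_sum:
  assumes "\<And>i j. i \<in> A \<Longrightarrow> j \<in> B i \<Longrightarrow> f i j \<in> borel_measurable M"
  shows "(\<integral>\<^sup>+x. (\<Sum>i\<in>A. \<Sum>j\<in>B i. f i j x) \<partial>M) = (\<Sum>i\<in>A. \<Sum>j\<in>B i. \<integral>\<^sup>+x. f i j x \<partial>M)"
  using assms by (simp add: nn_integral_sum borel_measurable_sum)

lemma pos_cone_sets: "pos_cone d \<in> sets (lebesgue_prod {1..d})"
proof -
  have "pos_cone d = {x \<in> space (\<Pi>\<^sub>M i\<in>{1..d}. borel). \<forall>i\<in>{1..d}. 0 < x i}"
    by (auto simp: pos_cone_def space_PiM)
  also have "\<dots> \<in> sets (\<Pi>\<^sub>M i\<in>{1..d}. borel)" by measurable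
  finally show ?thesis by (simp only: sets_lebesgue_prod)
qed

lemma top_two_sets:
  assumes ij: "i \<in> {1..d}" "j \<in> {1..d}"
  shows "top_two d i j \<in> sets (lebesgue_prod {1..d})"
proof -
  let ?L = "lebesgue_prod {1..d}"
  have less: "{x \<in> space ?L. x a < x b} \<in> sets ?L" if "a \<in> {1..d}" "b \<in> {1..d}" for a b
    using that by (intro borel_measurable_less measurable_coord)
  have ne: "{1..d} \<noteq> {}" using ij by blast
  have distinct: "{x \<in> space ?L. \<forall>a\<in>{1..d}. \<forall>b\<in>{1..d}. a = b \<or> (x a < x b \<or> x b < x a)} \<in> sets ?L"
    using ne by (intro sets.sets_Collect_finite_All' sets.sets_Collect_disj sets.sets_Collect_const less finite_atLeastAtMost)
  have max: "{x \<in> space ?L. \<forall>k\<in>{1..d}. k \<in> {i, j} \<or> x k < x j} \<in> sets ?L"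
    using ne ij by (intro sets.sets_Collect_finite_All' sets.sets_Collect_disj sets.sets_Collect_const less finite_atLeastAtMost)
  have "inj_on x {1..d} \<longleftrightarrow> (\<forall>a\<in>{1..d}. \<forall>b\<in>{1..d}. a = b \<or> (x a < x b \<or> x b < x a))" for x :: "nat \<Rightarrow> real"
    unfolding inj_on_def by (metis less_irrefl linorder_less_linear)
  moreover have "(\<forall>k\<in>{1..d} - {i, j}. x k < x j) \<longleftrightarrow> (\<forall>k\<in>{1..d}. k \<in> {i, j} \<or> x k < x j)" for x :: "nat \<Rightarrow> real"
    by blast
  moreover have "x \<in> space ?L" if "x \<in> pos_cone d" for x
    using that by (auto simp: pos_cone_def space_PiM)
  ultimately have "x \<in> top_two d i j \<longleftrightarrow> x \<in> pos_cone d \<inter>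
      {x \<in> space ?L. \<forall>a\<in>{1..d}. \<forall>b\<in>{1..d}. a = b \<or> (x a < x b \<or> x b < x a)} \<inter>
      {x \<in> space ?L. x j < x i} \<inter> {x \<in> space ?L. \<forall>k\<in>{1..d}. k \<in> {i, j} \<or> x k < x j}" for x
    unfolding top_two_def Int_iff mem_Collect_eq by (cases "x \<in> pos_cone d") (simp_all only: simp_thms conj_assoc)
  then have "top_two d i j = pos_cone d \<inter>
      {x \<in> space ?L. \<forall>a\<in>{1..d}. \<forall>b\<in>{1..d}. a = b \<or> (x a < x b \<or> x b < x a)} \<inter>
      {x \<in> space ?L. x j < x i} \<inter> {x \<in> space ?L. \<forall>k\<in>{1..d}. k \<in> {i, j} \<or> x k < x j}"
    by (rule set_eqI)
  then show ?thesis
    using pos_cone_sets[of d] distinct less[OF ij(2,1)] max by (simp only: sets.Int)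
qed

lemma measurable_chain_sum:
  assumes "S \<subseteq> I"
  shows "(\<lambda>x. chain_sum (recip_sum x) n R S) \<in> borel_measurable (lebesgue_prod I)"
  using assms
proof (induction n arbitrary: S)
  have recip: "(\<lambda>x. recip_sum x S) \<in> borel_measurable (lebesgue_prod I)" if "S \<subseteq> I" for S
    unfolding recip_sum_def using that
    by (intro borel_measurable_divide borel_measurable_const borel_measurable_sum measurable_coord) blast
  case 0
  then show ?case by (simp add: recip)
  case (Suc n)
  have "(\<lambda>x. \<Sum>a\<in>S - R. chain_sum (recip_sum x) n R (S - {a})) \<in> borel_measurable (lebesgue_prod I)"
    using Suc.prems by (intro borel_measurable_sum Suc.IH) blast
  with recip[OF Suc.prems] show ?case
    unfolding chain_sum.simps by (rule borel_measurable_times)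
qed

lemma measurable_branch_density:
  assumes "j \<in> {1..d}"
  shows "branch_density d i j \<in> borel_measurable (lebesgue_prod {1..d})"
  unfolding branch_density_def[abs_def]
  using assms by (intro borel_measurable_divide borel_measurable_times borel_measurable_const
      measurable_chain_sum measurable_coord) auto

lemma measurable_branch_term:
  assumes "i \<in> {1..d}" "j \<in> {1..d}"
  shows "(\<lambda>x. indicator (top_two d i j) x * branch_density d i j x) \<in> borel_measurable (lebesgue_prod {1..d})"
  using borel_measurable_indicator[OF top_two_sets[OF assms]] measurable_branch_density[OF assms(2)]
  by (rule borel_measurable_times)

lemma measurable_cone_density: "cone_density d \<in> borel_measurable (lebesgue_prod {1..d})"
  unfolding cone_density_def[abs_def]
  by (intro borel_measurable_sum measurable_branch_term) auto

lemma chain_sum_cong: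
  assumes "\<And>B. B \<subseteq> S \<Longrightarrow> v B = w B"
  shows "chain_sum v n R S = chain_sum w n R S"
  using assms
proof (induction n arbitrary: S)
  case (Suc n)
  have "chain_sum v n R (S - {a}) = chain_sum w n R (S - {a})" for a
    using Suc.prems by (intro Suc.IH) blast
  then show ?case using Suc.prems by simp
qed simp

definition dilate :: "nat \<Rightarrow> real \<Rightarrow> (nat \<Rightarrow> real) \<Rightarrow> nat \<Rightarrow> real" where
  "dilate d r x = (\<lambda>i\<in>{1..d}. r * x i)"

lemma dilate_apply: "i \<in> {1..d} \<Longrightarrow> dilate d r x i = r * x i"
  by (simp add: dilate_def)

lemma branch_density_dilate:
  assumes d: "2 \<le> d" and j: "j \<in> {1..d}" and r: "0 < r"
  shows "branch_density d i j (dilate d r x) = (1 / r) ^ d * branch_density d i j x"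
proof -
  have "chain_sum (recip_sum (dilate d r x)) (d - 2) {i} ({1..d} - {j}) =
      chain_sum (\<lambda>B. 1 / r * recip_sum x B) (d - 2) {i} ({1..d} - {j})"
  proof (rule chain_sum_cong)
    fix B assume "B \<subseteq> {1..d} - {j}"
    then have "(\<Sum>b\<in>B. dilate d r x b) = r * (\<Sum>b\<in>B. x b)"
      unfolding sum_distrib_left by (intro sum.cong refl dilate_apply) blast
    then show "recip_sum (dilate d r x) B = 1 / r * recip_sum x B" by (simp add: recip_sum_def)
  qed
  also have "\<dots> = (1 / r) ^ (d - 1) * chain_sum (recip_sum x) (d - 2) {i} ({1..d} - {j})"
  proof -
    have "Suc (d - 2) = d - 1" using d by simp
    then show ?thesis using chain_sum_scale[of "1 / r" "recip_sum x" "d - 2"] by (simp only:)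
  qed
  finally have "branch_density d i j (dilate d r x) = (1 / r) ^ (d - 1) * (1 / r) * branch_density d i j x"
    using j by (simp add: branch_density_def dilate_apply)
  also have "(1 / r) ^ (d - 1) * (1 / r) = (1 / r) ^ d"
    using d by (cases d) simp_all
  finally show ?thesis .
qed

lemma top_two_dilate:
  assumes "x \<in> std_simplex d" "i \<in> {1..d}" "j \<in> {1..d}" "0 < r"
  shows "dilate d r x \<in> top_two d i j \<longleftrightarrow> x \<in> top_two d i j"
proof -
  have "x \<in> pos_cone d" "dilate d r x \<in> pos_cone d"
    using assms by (auto simp: std_simplex_def pos_cone_def dilate_def)
  moreover have "inj_on (dilate d r x) {1..d} \<longleftrightarrow> inj_on x {1..d}"
    using assms(4) by (simp add: inj_on_def dilate_apply)
  ultimately show ?thesis using assms(2-4) by (simp add: top_two_def dilate_apply)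
qed

definition project :: "nat \<Rightarrow> (nat \<Rightarrow> real) \<Rightarrow> nat \<Rightarrow> real" where
  "project d y = (\<lambda>k\<in>{1..d}. y k / (\<Sum>i\<in>{1..d}. y i))"

lemma project_dilate:
  assumes "0 < r" shows "project d (dilate d r x) = project d x"
proof -
  have "(\<Sum>i\<in>{1..d}. dilate d r x i) = r * (\<Sum>i\<in>{1..d}. x i)"
    unfolding sum_distrib_left by (intro sum.cong refl dilate_apply)
  then show ?thesis using assms unfolding project_def
    by (intro restrict_ext) (simp add: dilate_apply)
qed

lemma project_std_simplex: "x \<in> std_simplex d \<Longrightarrow> project d x = x"
  by (auto simp: project_def std_simplex_def pos_cone_def PiE_def extensional_def fun_eq_iff)

lemma measurable_coord_sum: "(\<lambda>x. \<Sum>i\<in>I. x i) \<in> borel_measurable (lebesgue_prod I)"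
  by (intro borel_measurable_sum measurable_coord)

lemma measurable_project: "project d \<in> lebesgue_prod {1..d} \<rightarrow>\<^sub>M lebesgue_prod {1..d}"
proof (rule measurable_into_lebesgue_prod)
  fix k assume k: "k \<in> {1..d}"
  have "(\<lambda>x. x k / (\<Sum>i\<in>{1..d}. x i)) \<in> borel_measurable (lebesgue_prod {1..d})"
    using k by (intro borel_measurable_divide measurable_coord measurable_coord_sum)
  then show "(\<lambda>x. project d x k) \<in> borel_measurable (lebesgue_prod {1..d})"
    using k by (simp add: project_def)
qed (simp add: project_def)

definition brun_step :: "nat \<Rightarrow> nat \<Rightarrow> (nat \<Rightarrow> real) \<Rightarrow> nat \<Rightarrow> real" where
  "brun_step i j x = x(i := x i - x j)"

lemma measurable_brun_step:
  assumes "i \<in> I" "j \<in> I"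
  shows "brun_step i j \<in> lebesgue_prod I \<rightarrow>\<^sub>M lebesgue_prod I"
  unfolding brun_step_def[abs_def]
  using assms by (intro measurable_coord_update borel_measurable_diff measurable_coord)

lemma brun_step_dilate:
  assumes "i \<in> {1..d}" "j \<in> {1..d}"
  shows "brun_step i j (dilate d r x) = dilate d r (brun_step i j x)"
  using assms by (auto simp: brun_step_def dilate_def fun_eq_iff right_diff_distrib)

lemma brun_step_pos_cone:
  assumes "x \<in> top_two d i j" "i \<in> {1..d}"
  shows "brun_step i j x \<in> pos_cone d"
  using assms by (auto simp: top_two_def pos_cone_def brun_step_def PiE_def extensional_def)

lemma sum_brun_step:
  assumes "i \<in> {1..d}"
  shows "(\<Sum>k\<in>{1..d}. brun_step i j x k) = (\<Sum>k\<in>{1..d}. x k) - x j"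
proof -
  have "(\<Sum>k\<in>{1..d}. brun_step i j x k) = x i - x j + (\<Sum>k\<in>{1..d} - {i}. x k)"
    using assms by (subst sum.remove[of _ i]) (auto simp: brun_step_def)
  also have "\<dots> = (\<Sum>k\<in>{1..d}. x k) - x j"
    using sum.remove[of "{1..d}" i x] assms by simp
  finally show ?thesis .
qed

lemma brun_proj_top_two:
  assumes d: "2 \<le> d" and x: "x \<in> top_two d i j" and ij: "i \<in> {1..d}" "j \<in> {1..d}" "i \<noteq> j"
  shows "brun_proj d x = project d (brun_step i j x)"
proof -
  obtain \<pi> where \<pi>: "\<pi> permutes {1..d}" "x \<in> perm_cone d \<pi>"
    using perm_cone_exists[of x d] x by (auto simp: top_two_def)
  have \<pi>U: "\<pi> d \<in> {1..d}" "\<pi> (d - 1) \<in> {1..d}" "\<pi> d \<noteq> \<pi> (d - 1)"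
    using d permutes_in_image[OF \<pi>(1)] by (auto simp: inj_eq[OF permutes_inj[OF \<pi>(1)]])
  have "\<pi> d = i \<and> \<pi> (d - 1) = j"
    using top_two_unique[OF x perm_cone_top_two[OF d \<pi>]] ij \<pi>U by blast
  then have brun: "brun d x = brun_step i j x"
    using order_perm_eq[OF \<pi>] by (simp add: brun_def brun_step_def)
  have "\<bar>brun_step i j x k\<bar> = brun_step i j x k" if "k \<in> {1..d}" for k
    using brun_step_pos_cone[OF x ij(1)] that by (intro abs_of_pos) (simp add: pos_cone_def)
  then have "norm1 d (brun_step i j x) = (\<Sum>k\<in>{1..d}. brun_step i j x k)"
    unfolding norm1_def by (rule sum.cong[OF refl])
  then show ?thesis by (simp add: brun_proj_def project_def brun)
qed

lemma sets_simplex_borelD: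
  assumes "B \<in> sets (simplex_borel d)"
  shows "B \<in> sets (lebesgue_prod {1..d})" "B \<subseteq> std_simplex d"
proof -
  have "std_simplex d \<inter> space (\<Pi>\<^sub>M i\<in>{1..d}. borel) \<in> sets (\<Pi>\<^sub>M i\<in>{1..d}. borel :: real measure)"
    using std_simplex_sets by (rule sets.Int) simp
  then show "B \<in> sets (lebesgue_prod {1..d})" "B \<subseteq> std_simplex d"
    using assms by (simp_all add: simplex_borel_def sets_restrict_space_iff sets_lebesgue_prod)
qed

lemma sets_simplex_borelI:
  assumes "B \<in> sets (lebesgue_prod {1..d})" "B \<subseteq> std_simplex d"
  shows "B \<in> sets (simplex_borel d)"
proof -
  have "std_simplex d \<inter> space (\<Pi>\<^sub>M i\<in>{1..d}. borel) \<in> sets (\<Pi>\<^sub>M i\<in>{1..d}. borel :: real measure)"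
    using std_simplex_sets by (rule sets.Int) simp
  then show ?thesis
    using assms by (simp add: simplex_borel_def sets_restrict_space_iff sets_lebesgue_prod)
qed

lemma brun_preimage_eq:
  assumes d: "2 \<le> d"
  shows "{x \<in> regular_simplex d. brun_proj d x \<in> B} =
    (\<Union>i\<in>{1..d}. \<Union>j\<in>{1..d} - {i}. std_simplex d \<inter> top_two d i j \<inter> {x. project d (brun_step i j x) \<in> B})"
  (is "?L = ?R")
proof (intro equalityI subsetI)
  fix x assume x: "x \<in> ?L"
  then have "x \<in> std_simplex d" "x \<in> pos_cone d" "inj_on x {1..d}"
    using regular_simplex_iff[OF d] by (auto simp: std_simplex_def)
  moreover obtain i j where ij: "i \<in> {1..d}" "j \<in> {1..d}" "i \<noteq> j" and top: "x \<in> top_two d i j"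
    using top_two_exists[OF d calculation(2,3)] .
  moreover have "project d (brun_step i j x) \<in> B"
    using x brun_proj_top_two[OF d top ij] by simp
  ultimately show "x \<in> ?R" by blast
next
  fix x assume "x \<in> ?R"
  then obtain i j where ij: "i \<in> {1..d}" "j \<in> {1..d}" "i \<noteq> j" and x: "x \<in> top_two d i j"
    and "x \<in> std_simplex d" "project d (brun_step i j x) \<in> B" by blast
  moreover from x have "inj_on x {1..d}" by (simp add: top_two_def)
  ultimately show "x \<in> ?L"
    using regular_simplex_iff[OF d] brun_proj_top_two[OF d x ij] by simp
qed

lemma measurable_indicator_project:
  assumes "B \<in> sets (simplex_borel d)"
  shows "(\<lambda>x. indicator B (project d x) :: ennreal) \<in> borel_measurable (lebesgue_prod {1..d})"
  by (rule measurable_compose[OF measurable_project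
        borel_measurable_indicator[OF sets_simplex_borelD(1)[OF assms]]])

lemma brun_preimage_sets:
  assumes d: "2 \<le> d" and B: "B \<in> sets (simplex_borel d)"
  shows "{x \<in> regular_simplex d. brun_proj d x \<in> B} \<in> sets (simplex_borel d)"
  unfolding brun_preimage_eq[OF d]
proof (rule sets_simplex_borelI)
  show "(\<Union>i\<in>{1..d}. \<Union>j\<in>{1..d} - {i}. std_simplex d \<inter> top_two d i j \<inter> {x. project d (brun_step i j x) \<in> B})
      \<in> sets (lebesgue_prod {1..d})"
  proof (intro sets.finite_UN finite_atLeastAtMost finite_Diff)
    fix i j assume ij: "i \<in> {1..d}" "j \<in> {1..d} - {i}"
    then have j: "j \<in> {1..d}" by blast
    have "(project d \<circ> brun_step i j) -` B \<inter> space (lebesgue_prod {1..d}) \<in> sets (lebesgue_prod {1..d})"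
      by (rule measurable_sets[OF measurable_comp[OF measurable_brun_step[OF ij(1) j] measurable_project]
            sets_simplex_borelD(1)[OF B]])
    then have "std_simplex d \<inter> top_two d i j \<inter>
        ((project d \<circ> brun_step i j) -` B \<inter> space (lebesgue_prod {1..d})) \<in> sets (lebesgue_prod {1..d})"
      using std_simplex_sets[of d, folded sets_lebesgue_prod] top_two_sets[OF ij(1) j] by blast
    moreover have "std_simplex d \<subseteq> space (lebesgue_prod {1..d})"
      by (auto simp: std_simplex_def pos_cone_def space_PiM)
    then have "std_simplex d \<inter> top_two d i j \<inter>
        ((project d \<circ> brun_step i j) -` B \<inter> space (lebesgue_prod {1..d})) =
        std_simplex d \<inter> top_two d i j \<inter> {x. project d (brun_step i j x) \<in> B}"
      by auto
    ultimately show "std_simplex d \<inter> top_two d i j \<inter> {x. project d (brun_step i j x) \<in> B}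
        \<in> sets (lebesgue_prod {1..d})"
      by (simp only:)
  qed
qed blast

text \<open>
  One branch of the algorithm. The integral over the simplex is rewritten as an integral over the
  cone with the norm of \<open>brun_step i j x\<close> as gauge. Then the integrand depends on \<open>x\<close>, apart from
  the density, only through \<open>brun_step i j x\<close>, and undoing the step is a shear.
\<close>

lemma nn_integral_brun_branch:
  assumes d: "2 \<le> d" and B: "B \<in> sets (simplex_borel d)"
    and ij: "i \<in> {1..d}" "j \<in> {1..d}" "i \<noteq> j"
  shows "(\<integral>\<^sup>+x. ennreal (indicator (top_two d i j) x * branch_density d i j x) *
        indicator B (project d (brun_step i j x)) \<partial>simplex_lebesgue d) =
    (\<integral>\<^sup>+y. ennreal (indicator (top_two d i j) (y(i := y j + y i)) * branch_density d i j (y(i := y j + y i))) *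
        (indicator (pos_cone d) y * indicator B (project d y) * unit_window (\<Sum>k\<in>{1..d}. y k))
      \<partial>lebesgue_prod {1..d})"
proof -
  let ?L = "lebesgue_prod {1..d}"
  define D where "D x = indicator (top_two d i j) x * branch_density d i j x" for x
  define u :: "(nat \<Rightarrow> real) \<Rightarrow> ennreal" where
    "u y = indicator (pos_cone d) y * indicator B (project d y) * unit_window (\<Sum>k\<in>{1..d}. y k)" for y
  have D: "(\<lambda>x. ennreal (D x)) \<in> borel_measurable ?L"
    unfolding D_def using measurable_branch_term[OF ij(1,2)] by (rule measurable_compose[OF _ measurable_ennreal])
  have u: "u \<in> borel_measurable ?L"
    unfolding u_def
    by (intro borel_measurable_times_ennreal borel_measurable_indicator pos_cone_sets
        measurable_indicator_project[OF B] measurable_compose[OF measurable_coord_sum measurable_unit_window])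
  have "(\<integral>\<^sup>+x. ennreal (D x) * indicator B (project d (brun_step i j x)) \<partial>simplex_lebesgue d) =
      (\<integral>\<^sup>+x. ennreal (D x) * indicator B (project d (brun_step i j x)) *
        unit_window ((\<Sum>k\<in>{1..d}. x k) - x j) \<partial>?L)"
  proof (rule nn_integral_simplex_eq_cone[symmetric])
    show "1 \<le> d" using d by simp
    show "(\<lambda>x. ennreal (D x) * indicator B (project d (brun_step i j x))) \<in> borel_measurable ?L"
      using D measurable_compose[OF measurable_brun_step[OF ij(1,2)] measurable_indicator_project[OF B]]
      by (rule borel_measurable_times_ennreal)
    show "(\<lambda>x. (\<Sum>k\<in>{1..d}. x k) - x j) \<in> borel_measurable ?L"
      using ij(2) by (intro borel_measurable_diff measurable_coord_sum measurable_coord)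
    show "ennreal (D x) * indicator B (project d (brun_step i j x)) = 0" if "x \<notin> pos_cone d" for x
      using that by (simp add: D_def top_two_def)
    show "0 < (\<Sum>k\<in>{1..d}. x k) - x j" if x: "x \<in> std_simplex d" for x
    proof -
      have "0 < (\<Sum>k\<in>{1..d} - {j}. x k)"
        using x ij by (intro sum_pos) (auto simp: std_simplex_def pos_cone_def)
      then show ?thesis using ij(2) by (simp add: sum_diff1)
    qed
    fix r :: real and x assume r: "0 < r" and x: "x \<in> std_simplex d"
    have "D (dilate d r x) = (1 / r) ^ d * D x"
      unfolding D_def using branch_density_dilate[OF d ij(2) r] top_two_dilate[OF x ij(1,2) r]
      by (simp add: indicator_def)
    then have "ennreal (D (dilate d r x)) = ennreal ((1 / r) ^ d) * ennreal (D x)"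
      using r by (simp add: ennreal_mult')
    moreover have "project d (brun_step i j (dilate d r x)) = project d (brun_step i j x)"
      using project_dilate[OF r] brun_step_dilate[OF ij(1,2)] by simp
    ultimately show "ennreal (D (\<lambda>i\<in>{1..d}. r * x i)) *
        indicator B (project d (brun_step i j (\<lambda>i\<in>{1..d}. r * x i))) =
        ennreal ((1 / r) ^ d) * (ennreal (D x) * indicator B (project d (brun_step i j x)))"
      by (simp only: dilate_def[symmetric] mult.assoc)
    have "(\<Sum>k\<in>{1..d}. (\<lambda>i\<in>{1..d}. r * x i) k) = r * (\<Sum>k\<in>{1..d}. x k)"
      unfolding sum_distrib_left by (intro sum.cong) simp_all
    then show "(\<Sum>k\<in>{1..d}. (\<lambda>i\<in>{1..d}. r * x i) k) - (\<lambda>i\<in>{1..d}. r * x i) j =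
        r * ((\<Sum>k\<in>{1..d}. x k) - x j)"
      using ij(2) by (simp add: right_diff_distrib)
  qed
  also have "\<dots> = (\<integral>\<^sup>+x. ennreal (D x) * u (brun_step i j x) \<partial>?L)"
  proof (rule nn_integral_cong)
    fix x
    show "ennreal (D x) * indicator B (project d (brun_step i j x)) * unit_window ((\<Sum>k\<in>{1..d}. x k) - x j) =
        ennreal (D x) * u (brun_step i j x)"
    proof (cases "x \<in> top_two d i j")
      case True
      then show ?thesis
        using brun_step_pos_cone[OF True ij(1)] by (simp only: u_def sum_brun_step[OF ij(1)]) (simp add: mult.assoc)
    qed (simp add: D_def)
  qed
  also have "\<dots> = ennreal \<bar>1\<bar> * (\<integral>\<^sup>+y. ennreal (D (y(i := y j + 1 * y i))) * u (brun_step i j (y(i := y j + 1 * y i))) \<partial>?L)"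
  proof (rule nn_integral_affine_coord)
    show "(\<lambda>x. ennreal (D x) * u (brun_step i j x)) \<in> borel_measurable ?L"
      using D measurable_compose[OF measurable_brun_step[OF ij(1,2)] u] by (rule borel_measurable_times_ennreal)
  qed (use ij measurable_coord in auto)
  also have "\<dots> = (\<integral>\<^sup>+y. ennreal (D (y(i := y j + y i))) * u y \<partial>?L)"
    using ij(3) by (simp add: brun_step_def)
  finally show ?thesis by (simp only: D_def u_def)
qed

lemma nn_integral_cone_density:
  assumes d: "2 \<le> d" and B: "B \<in> sets (simplex_borel d)"
  shows "(\<integral>\<^sup>+x. ennreal (cone_density d x) * indicator B x \<partial>simplex_lebesgue d) =
    (\<integral>\<^sup>+y. ennreal (cone_density d y) * indicator B (project d y) * unit_window (\<Sum>k\<in>{1..d}. y k)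
      \<partial>lebesgue_prod {1..d})"
proof -
  have "space (simplex_lebesgue d) \<subseteq> std_simplex d"
    by (auto simp: simplex_lebesgue_def simplex_borel_def space_restrict_space)
  then have "(\<integral>\<^sup>+x. ennreal (cone_density d x) * indicator B x \<partial>simplex_lebesgue d) =
      (\<integral>\<^sup>+x. ennreal (cone_density d x) * indicator B (project d x) \<partial>simplex_lebesgue d)"
    by (intro nn_integral_cong) (auto simp: project_std_simplex)
  also have "\<dots> = (\<integral>\<^sup>+y. ennreal (cone_density d y) * indicator B (project d y) *
      unit_window (\<Sum>k\<in>{1..d}. y k) \<partial>lebesgue_prod {1..d})"
  proof (rule nn_integral_simplex_eq_cone[symmetric])
    show "1 \<le> d" using d by simp
    show "(\<lambda>x. ennreal (cone_density d x) * indicator B (project d x)) \<in> borel_measurable (lebesgue_prod {1..d})"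
      by (intro borel_measurable_times_ennreal measurable_compose[OF measurable_cone_density measurable_ennreal]
          measurable_indicator_project[OF B])
    show "(\<lambda>x. \<Sum>k\<in>{1..d}. x k) \<in> borel_measurable (lebesgue_prod {1..d})" by (rule measurable_coord_sum)
    show "ennreal (cone_density d x) * indicator B (project d x) = 0" if "x \<notin> pos_cone d" for x
      using that cone_density_eq_0 by simp
    show "0 < (\<Sum>k\<in>{1..d}. x k)" if "x \<in> std_simplex d" for x
      using that by (simp add: std_simplex_def)
    fix r :: real and x assume r: "0 < r" and x: "x \<in> std_simplex d"
    have "cone_density d (dilate d r x) = (1 / r) ^ d * cone_density d x"
      unfolding cone_density_def sum_distrib_left
    proof (intro sum.cong refl)
      fix i j assume ij: "i \<in> {1..d}" "j \<in> {1..d} - {i}"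
      then have j: "j \<in> {1..d}" by blast
      show "indicator (top_two d i j) (dilate d r x) * branch_density d i j (dilate d r x) =
          (1 / r) ^ d * (indicator (top_two d i j) x * branch_density d i j x)"
        using branch_density_dilate[OF d j r] top_two_dilate[OF x ij(1) j r] by (simp add: indicator_def)
    qed
    then have "ennreal (cone_density d (dilate d r x)) = ennreal ((1 / r) ^ d) * ennreal (cone_density d x)"
      using r by (simp add: ennreal_mult')
    then show "ennreal (cone_density d (\<lambda>i\<in>{1..d}. r * x i)) * indicator B (project d (\<lambda>i\<in>{1..d}. r * x i)) =
        ennreal ((1 / r) ^ d) * (ennreal (cone_density d x) * indicator B (project d x))"
      using project_dilate[OF r] by (simp only: dilate_def[symmetric] mult.assoc)
    show "(\<Sum>k\<in>{1..d}. (\<lambda>i\<in>{1..d}. r * x i) k) = r * (\<Sum>k\<in>{1..d}. x k)"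
      unfolding sum_distrib_left by (intro sum.cong) simp_all
  qed
  finally show ?thesis .
qed

lemma measurable_on_simplex:
  assumes "f \<in> borel_measurable (lebesgue_prod {1..d})"
  shows "f \<in> borel_measurable (simplex_lebesgue d)"
  using measurable_simplex_borelI[OF assms] by (simp add: simplex_lebesgue_def)

lemma cone_density_eq_sum_ennreal:
  "ennreal (cone_density d x) =
    (\<Sum>i\<in>{1..d}. \<Sum>j\<in>{1..d} - {i}. ennreal (indicator (top_two d i j) x * branch_density d i j x))"
  unfolding cone_density_def by (intro ennreal_double_sum branch_term_nonneg) auto

text \<open>
  At a point with distinct coordinates at most one term of the sum, that of the two largest
  coordinates, is nonzero; at other points both sides vanish.
\<close>

lemma cone_density_preimage:
  assumes d: "2 \<le> d" and x: "x \<in> std_simplex d"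
  shows "ennreal (cone_density d x) * indicator {x \<in> regular_simplex d. brun_proj d x \<in> B} x =
    (\<Sum>i\<in>{1..d}. \<Sum>j\<in>{1..d} - {i}. ennreal (indicator (top_two d i j) x * branch_density d i j x) *
      indicator B (project d (brun_step i j x)))"
proof (cases "inj_on x {1..d}")
  case False
  then show ?thesis using cone_density_eq_0[of x d] by (simp add: top_two_def)
next
  case True
  have "indicator {x \<in> regular_simplex d. brun_proj d x \<in> B} x = (indicator B (brun_proj d x) :: ennreal)"
    using True x regular_simplex_iff[OF d] by (simp add: indicator_def)
  moreover have "ennreal (indicator (top_two d i j) x * branch_density d i j x) * indicator B (brun_proj d x) =
      ennreal (indicator (top_two d i j) x * branch_density d i j x) * indicator B (project d (brun_step i j x))"
    if "i \<in> {1..d}" "j \<in> {1..d} - {i}" for i j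
    using brun_proj_top_two[OF d, of x i j] that by (cases "x \<in> top_two d i j") auto
  ultimately show ?thesis
    unfolding cone_density_eq_sum_ennreal sum_distrib_right
    by (simp only: cong: sum.cong)
qed

theorem proposition28:
  fixes d :: nat
  assumes "d \<ge> 2"
  shows "brun_density d \<in> borel_measurable (simplex_lebesgue d) \<and>
    (\<forall>x\<in>std_simplex d. 0 \<le> brun_density d x) \<and>
    (\<forall>B\<in>sets (simplex_borel d).
       {x \<in> regular_simplex d. brun_proj d x \<in> B} \<in> sets (simplex_borel d) \<and>
       emeasure (brun_measure d) {x \<in> regular_simplex d. brun_proj d x \<in> B} =
         emeasure (brun_measure d) B)"
proof -
  let ?L = "lebesgue_prod {1..d}"
  let ?D = "\<lambda>i j x. ennreal (indicator (top_two d i j) x * branch_density d i j x)"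
  let ?u = "\<lambda>B y. indicator (pos_cone d) y * indicator B (project d y) * unit_window (\<Sum>k\<in>{1..d}. y k) :: ennreal"
  have space: "space (simplex_lebesgue d) \<subseteq> std_simplex d"
    by (auto simp: simplex_lebesgue_def simplex_borel_def space_restrict_space)
  have eq: "brun_density d x = cone_density d x" if "x \<in> space (simplex_lebesgue d)" for x
    using brun_density_eq_cone_density[OF assms] that space by blast
  have meas: "brun_density d \<in> borel_measurable (simplex_lebesgue d)"
    using measurable_on_simplex[OF measurable_cone_density] eq by (simp cong: measurable_cong)
  have sets: "sets (simplex_lebesgue d) = sets (simplex_borel d)" by (simp add: simplex_lebesgue_def)
  have emeasure: "emeasure (brun_measure d) B = (\<integral>\<^sup>+x. ennreal (cone_density d x) * indicator B x \<partial>simplex_lebesgue d)"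
    if "B \<in> sets (simplex_borel d)" for B
  proof -
    have "emeasure (brun_measure d) B = (\<integral>\<^sup>+x. ennreal (brun_density d x) * indicator B x \<partial>simplex_lebesgue d)"
      unfolding brun_measure_def
      by (rule emeasure_density[OF measurable_compose[OF meas measurable_ennreal]]) (simp only: sets that)
    also have "\<dots> = (\<integral>\<^sup>+x. ennreal (cone_density d x) * indicator B x \<partial>simplex_lebesgue d)"
      by (intro nn_integral_cong) (simp only: eq)
    finally show ?thesis .
  qed
  have "emeasure (brun_measure d) {x \<in> regular_simplex d. brun_proj d x \<in> B} = emeasure (brun_measure d) B"
    if B: "B \<in> sets (simplex_borel d)" for B
  proof -
    have u: "?u B \<in> borel_measurable ?L"
      by (intro borel_measurable_times_ennreal borel_measurable_indicator pos_cone_sets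
          measurable_indicator_project[OF B] measurable_compose[OF measurable_coord_sum measurable_unit_window])
    have D: "?D i j \<in> borel_measurable ?L" if "i \<in> {1..d}" "j \<in> {1..d} - {i}" for i j
      using that by (intro measurable_compose[OF measurable_branch_term measurable_ennreal]) auto
    have D': "(\<lambda>y. ?D i j (y(i := y j + y i))) \<in> borel_measurable ?L"
      if ij: "i \<in> {1..d}" "j \<in> {1..d} - {i}" for i j
      using ij by (intro measurable_compose[OF measurable_coord_update D] borel_measurable_add measurable_coord) auto
    have "emeasure (brun_measure d) {x \<in> regular_simplex d. brun_proj d x \<in> B} =
        (\<integral>\<^sup>+x. (\<Sum>i\<in>{1..d}. \<Sum>j\<in>{1..d} - {i}. ?D i j x * indicator B (project d (brun_step i j x))) \<partial>simplex_lebesgue d)"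
      unfolding emeasure[OF brun_preimage_sets[OF assms B]]
      using space by (intro nn_integral_cong cone_density_preimage[OF assms]) blast
    also have "\<dots> = (\<Sum>i\<in>{1..d}. \<Sum>j\<in>{1..d} - {i}.
        \<integral>\<^sup>+x. ?D i j x * indicator B (project d (brun_step i j x)) \<partial>simplex_lebesgue d)"
    proof -
      have "(\<lambda>x. ?D i j x * indicator B (project d (brun_step i j x))) \<in> borel_measurable (simplex_lebesgue d)"
        if ij: "i \<in> {1..d}" "j \<in> {1..d} - {i}" for i j
        using ij by (intro measurable_on_simplex borel_measurable_times_ennreal D
            measurable_compose[OF measurable_brun_step measurable_indicator_project[OF B]]) auto
      then show ?thesis by (rule nn_integral_double_sum)
    qed
    also have "\<dots> = (\<Sum>i\<in>{1..d}. \<Sum>j\<in>{1..d} - {i}. \<integral>\<^sup>+y. ?D i j (y(i := y j + y i)) * ?u B y \<partial>?L)"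
      by (intro sum.cong refl nn_integral_brun_branch[OF assms B]) auto
    also have "\<dots> = (\<integral>\<^sup>+y. (\<Sum>i\<in>{1..d}. \<Sum>j\<in>{1..d} - {i}. ?D i j (y(i := y j + y i)) * ?u B y) \<partial>?L)"
    proof -
      have "(\<lambda>y. ?D i j (y(i := y j + y i)) * ?u B y) \<in> borel_measurable ?L"
        if "i \<in> {1..d}" "j \<in> {1..d} - {i}" for i j
        using D'[OF that] u by (rule borel_measurable_times_ennreal)
      then show ?thesis by (rule nn_integral_double_sum[symmetric])
    qed
    also have "\<dots> = (\<integral>\<^sup>+y. ennreal (cone_density d y) * indicator B (project d y) *
        unit_window (\<Sum>k\<in>{1..d}. y k) \<partial>?L)"
    proof (rule nn_integral_cong_AE)
      have "AE y in ?L. inj_on y {1..d}" by (rule AE_distinct_coords) simp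
      then show "AE y in ?L. (\<Sum>i\<in>{1..d}. \<Sum>j\<in>{1..d} - {i}. ?D i j (y(i := y j + y i)) * ?u B y) =
          ennreal (cone_density d y) * indicator B (project d y) * unit_window (\<Sum>k\<in>{1..d}. y k)"
      proof eventually_elim
        fix y :: "nat \<Rightarrow> real" assume inj: "inj_on y {1..d}"
        show "(\<Sum>i\<in>{1..d}. \<Sum>j\<in>{1..d} - {i}. ?D i j (y(i := y j + y i)) * ?u B y) =
          ennreal (cone_density d y) * indicator B (project d y) * unit_window (\<Sum>k\<in>{1..d}. y k)"
        proof (cases "y \<in> pos_cone d")
          case False
          then show ?thesis using cone_density_eq_0[of y d] by simp
        next
          case True
          have "(\<Sum>i\<in>{1..d}. \<Sum>j\<in>{1..d} - {i}. ?D i j (y(i := y j + y i))) = ennreal (cone_density d y)"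
            unfolding cone_density_invariant[OF assms True inj, symmetric]
            by (intro ennreal_double_sum[symmetric] branch_term_nonneg) auto
          then have "(\<Sum>i\<in>{1..d}. \<Sum>j\<in>{1..d} - {i}. ?D i j (y(i := y j + y i)) * ?u B y) =
              ennreal (cone_density d y) * ?u B y"
            by (simp only: sum_distrib_right[symmetric])
          then show ?thesis using True by (simp add: mult.assoc)
        qed
      qed
    qed
    also have "\<dots> = emeasure (brun_measure d) B"
      unfolding emeasure[OF B] by (rule nn_integral_cone_density[OF assms B, symmetric])
    finally show ?thesis .
  qed
  moreover have "0 \<le> brun_density d x" if "x \<in> std_simplex d" for x
    using brun_density_eq_cone_density[OF assms that] cone_density_nonneg by simp
  ultimately show ?thesis using meas brun_preimage_sets[OF assms] by blast
qed

end
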